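(* Let $\mathbb K$ be an algebraically closed field of characteristic zero and let $I\subset R=\mathbb K[x,y,z]$ be an ideal of codimension $2$, minimally generated by three forms of degree $d\geq 2$. If $I$ has saturation exponent $1$ and satisfies the generic saturation condition (GSC), with saturation pivot $g$, then: (i) $I$ is a Cramer ideal with fixed column $(x,y,z)^t$ and companion $g$, where $g$ has degree $d-1+s$ for some $s\geq 1$. (ii) $I^{\rm sat}=\langle I,g\rangle$. (iii) $d$ is an odd integer. (iv) $\deg(g)=\frac{3}{2}(d-1)$; and ${\rm indeg}(I^{\rm sat}/I)\geq d+1$ if and only if $d\geq 5$. (v) The minimal graded free resolution of $R/I$ has the form $$0\rightarrow R\Bigl(-\tfrac{3}{2}(d+1)\Bigr)\rightarrow R\Bigl(-\tfrac{3d+1}{2}\Bigr)^3\rightarrow R(-d)^3\rightarrow R.$$ Conversely, if $I$ (of codimension $2$, minimally generated by three forms of degree $d\ge 2$) is a non-saturated Cramer ideal with fixed column $(x,y,z)^t$ and companion $g$, then $I$ has saturation exponent $1$ and satisfies condition GSC, with saturation pivot $g$.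
   Context: Let $\mathfrak m=\langle x,y,z\rangle$ and $I^{\rm sat}=I:\mathfrak m^{\infty}$. The saturation exponent of $I$ is the least integer $r\ge 0$ with $\mathfrak m^r I^{\rm sat}\subset I$; it equals $1$ exactly when $I$ is not saturated and $I^{\rm sat}=I:\mathfrak m$. For a graded module $M$, ${\rm indeg}(M)$ is the least degree of a nonzero homogeneous element of $M$ (with ${\rm indeg}(0)=+\infty$). Content matrix: let $I=\langle f_1,f_2,f_3\rangle$ have saturation exponent $1$ and let $g\in I^{\rm sat}$ be homogeneous. Then one can write $xg=a_1f_1+b_1f_2+c_1f_3$, $yg=a_2f_1+b_2f_2+c_2f_3$, $zg=a_3f_1+b_3f_2+c_3f_3$ with $a_i,b_i,c_i$ forms of one same degree $s$, and one sets $$M_g=\begin{pmatrix} x&a_1&b_1&c_1\\ y&a_2&b_2&c_2\\ z&a_3&b_3&c_3\end{pmatrix}$$ (such a matrix is not unique for given $g$ and given generators). Condition GSC: there exists a homogeneous element $g\in I^{\rm sat}\setminus I$ with such a matrix $M_g$ for which the ideal $I_3(M_g)$ generated by the $3\times 3$ minors of $M_g$ has codimension $2$ (the maximum possible). Such a $g$ is called a saturation pivot. Cramer ideal: let $\phi$ be an $n\times n$ matrix over a commutative ring with $g=\det\phi$ a nonzerodivisor, let $\mathbf u$ be a column of length $n$, and let $\psi=[\mathbf u\,|\,\phi]$. The ideal generated by the $n$ maximal minors of $\psi$ that involve the column $\mathbf u$ is called the Cramer ideal associated to the fixed column $\mathbf u$, and $g=\det\phi$ is its companion (minor). In the present graded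 situation $n=3$, $\mathbf u=(x,y,z)^t$, and the entries of $\phi$ are forms of one same degree. *)

theory Defs
  imports
    "HOL-Computational_Algebra.Polynomial"
    "HOL-Library.Extended_Nat"
    "Jordan_Normal_Form.Determinant"
    "Jordan_Normal_Form.DL_Submatrix"
    "Jordan_Normal_Form.Matrix_Kernel"
begin

section \<open>Ideals of a commutative ring\<close>

text \<open>An ideal is a submodule of the ring, regarded as a module over itself by multiplication.\<close>

lemma module_times: "Modules.module ((*) :: 'a::comm_ring_1 \<Rightarrow> 'a \<Rightarrow> 'a)"
  by unfold_locales (simp_all add: algebra_simps)

definition is_ideal :: "'a::comm_ring_1 set \<Rightarrow> bool" where
  "is_ideal = Modules.module.subspace (*)"

definition ideal_gen :: "'a::comm_ring_1 set \<Rightarrow> 'a set" where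
  "ideal_gen = Modules.module.span (*)"

definition is_prime_ideal :: "'a::comm_ring_1 set \<Rightarrow> bool" where
  "is_prime_ideal P \<longleftrightarrow> is_ideal P \<and> P \<noteq> UNIV \<and> (\<forall>a b. a * b \<in> P \<longrightarrow> a \<in> P \<or> b \<in> P)"

definition ideal_prod :: "'a::comm_ring_1 set \<Rightarrow> 'a set \<Rightarrow> 'a set" where
  "ideal_prod I J = ideal_gen {a * b | a b. a \<in> I \<and> b \<in> J}"

primrec ideal_pow :: "'a::comm_ring_1 set \<Rightarrow> nat \<Rightarrow> 'a set" where
  "ideal_pow I 0 = UNIV"
| "ideal_pow I (Suc n) = ideal_prod I (ideal_pow I n)"

definition colon :: "'a::comm_ring_1 set \<Rightarrow> 'a set \<Rightarrow> 'a set" where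
  "colon I J = {a. \<forall>b\<in>J. a * b \<in> I}"

text \<open>The height of a prime is the supremum of the lengths of chains of primes descending from it;
  the codimension of an ideal is the least height of a prime containing it
  (and \<open>\<infinity>\<close> for the unit ideal).\<close>

definition prime_height :: "'a::comm_ring_1 set \<Rightarrow> enat" where
  "prime_height P =
     Sup {enat n | n. \<exists>c :: nat \<Rightarrow> 'a set.
       (\<forall>i\<le>n. is_prime_ideal (c i)) \<and> (\<forall>i<n. c i \<subset> c (Suc i)) \<and> c n = P}"

definition codim :: "'a::comm_ring_1 set \<Rightarrow> enat" where
  "codim I = Inf {prime_height P | P. is_prime_ideal P \<and> I \<subseteq> P}"

definition minimally_generated_by :: "'a::comm_ring_1 set \<Rightarrow> 'a list \<Rightarrow> bool" where
  "minimally_generated_by I fs \<longleftrightarrow>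
     distinct fs \<and> I = ideal_gen (set fs) \<and> (\<forall>T. T \<subset> set fs \<longrightarrow> ideal_gen T \<noteq> I)"

section \<open>Determinantal ideals and Cramer ideals\<close>

definition det_ideal :: "nat \<Rightarrow> 'a::comm_ring_1 mat \<Rightarrow> 'a set" where
  "det_ideal k A = ideal_gen {det (submatrix A P Q) | P Q.
     P \<subseteq> {..<dim_row A} \<and> Q \<subseteq> {..<dim_col A} \<and> card P = k \<and> card Q = k}"

definition prepend_col :: "'a vec \<Rightarrow> 'a mat \<Rightarrow> 'a mat" where
  "prepend_col u A = mat_of_cols (dim_vec u) (u # cols A)"

text \<open>The column \<open>u\<close> has index \<open>0\<close> in \<open>prepend_col u \<phi>\<close>, so \<open>0 \<in> Q\<close> says that the minor
  involves it.\<close>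

definition cramer_ideal :: "'a::comm_ring_1 vec \<Rightarrow> 'a mat \<Rightarrow> 'a set" where
  "cramer_ideal u \<phi> = ideal_gen {det (submatrix (prepend_col u \<phi>) {..<dim_vec u} Q) | Q.
     Q \<subseteq> {..dim_vec u} \<and> card Q = dim_vec u \<and> 0 \<in> Q}"

definition nonzerodivisor :: "'a::comm_ring_1 \<Rightarrow> bool" where
  "nonzerodivisor a \<longleftrightarrow> (\<forall>b. a * b = 0 \<longrightarrow> b = 0)"

section \<open>The graded ring of polynomials in three variables\<close>

text \<open>\<open>K[x,y,z]\<close> is \<open>K[x][y][z]\<close>, the iterated univariate polynomial ring.\<close>

type_synonym 'k poly3 = "'k poly poly poly"

abbreviation var_x :: "'k::comm_ring_1 poly3" where "var_x \<equiv> [:[:[:0, 1:]:]:]"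
abbreviation var_y :: "'k::comm_ring_1 poly3" where "var_y \<equiv> [:[:0, 1:]:]"
abbreviation var_z :: "'k::comm_ring_1 poly3" where "var_z \<equiv> [:0, 1:]"

definition xyz :: "'k::comm_ring_1 poly3 vec" where
  "xyz = vec_of_list [var_x, var_y, var_z]"

definition irrelevant :: "'k::comm_ring_1 poly3 set" where
  "irrelevant = ideal_gen {var_x, var_y, var_z}"

text \<open>The coefficient of \<open>x\<^sup>i y\<^sup>j z\<^sup>k\<close>.\<close>

definition coeff3 :: "'k::comm_ring_1 poly3 \<Rightarrow> nat \<Rightarrow> nat \<Rightarrow> nat \<Rightarrow> 'k" where
  "coeff3 f i j k = coeff (coeff (coeff f k) j) i"

text \<open>The zero polynomial is a form of every degree, and the only form of a negative degree.\<close>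

definition form :: "int \<Rightarrow> 'k::comm_ring_1 poly3 \<Rightarrow> bool" where
  "form e f \<longleftrightarrow> (\<forall>i j k. coeff3 f i j k \<noteq> 0 \<longrightarrow> int (i + j + k) = e)"

definition total_deg :: "'k::comm_ring_1 poly3 \<Rightarrow> nat" where
  "total_deg f = (if f = 0 then 0 else Max {i + j + k | i j k. coeff3 f i j k \<noteq> 0})"

definition saturation :: "'k::comm_ring_1 poly3 set \<Rightarrow> 'k poly3 set" where
  "saturation I = (\<Union>n. colon I (ideal_pow irrelevant n))"

text \<open>The infimum is taken in \<open>enat\<close>: a finite value is attained, being a least element.\<close>

definition sat_exponent :: "'k::comm_ring_1 poly3 set \<Rightarrow> enat" where
  "sat_exponent I = Inf {enat r | r. ideal_prod (ideal_pow irrelevant r) (saturation I) \<subseteq> I}"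

text \<open>\<open>indeg (J/I)\<close> for homogeneous ideals \<open>I \<subseteq> J\<close>: the degree \<open>n\<close> component of \<open>J/I\<close> consists of
  the classes of the forms of degree \<open>n\<close> in \<open>J\<close>.\<close>

definition indeg_quotient :: "'k::comm_ring_1 poly3 set \<Rightarrow> 'k poly3 set \<Rightarrow> enat" where
  "indeg_quotient J I = Inf {enat n | n. \<exists>f\<in>J. form (int n) f \<and> f \<notin> I}"

section \<open>Content matrices, the generic saturation condition, graded Cramer ideals\<close>

text \<open>With \<open>M = [xyz | \<phi>]\<close>, row \<open>i\<close> of \<open>\<phi>\<close> is \<open>(a\<^sub>i, b\<^sub>i, c\<^sub>i)\<close>, and \<open>\<phi> *\<^sub>v f = g \<cdot>\<^sub>v xyz\<close> is the system
  \<open>x g = a\<^sub>1 f\<^sub>1 + b\<^sub>1 f\<^sub>2 + c\<^sub>1 f\<^sub>3\<close>, \<open>y g = \<dots>\<close>, \<open>z g = \<dots>\<close>.\<close>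

definition forms_mat :: "nat \<Rightarrow> 'k::comm_ring_1 poly3 mat \<Rightarrow> bool" where
  "forms_mat s \<phi> \<longleftrightarrow> (\<forall>i<dim_row \<phi>. \<forall>j<dim_col \<phi>. form (int s) (\<phi> $$ (i, j)))"

definition content_matrix ::
  "'k::comm_ring_1 poly3 list \<Rightarrow> 'k poly3 \<Rightarrow> 'k poly3 mat \<Rightarrow> bool" where
  "content_matrix fs g M \<longleftrightarrow> (\<exists>\<phi> s. \<phi> \<in> carrier_mat 3 3 \<and> forms_mat s \<phi> \<and>
     \<phi> *\<^sub>v vec_of_list fs = g \<cdot>\<^sub>v xyz \<and> M = prepend_col xyz \<phi>)"

definition saturation_pivot :: "'k::comm_ring_1 poly3 list \<Rightarrow> 'k poly3 \<Rightarrow> bool" where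
  "saturation_pivot fs g \<longleftrightarrow>
     g \<in> saturation (ideal_gen (set fs)) - ideal_gen (set fs) \<and> (\<exists>e. form e g) \<and>
     (\<exists>M. content_matrix fs g M \<and> codim (det_ideal 3 M) = 2)"

definition GSC :: "'k::comm_ring_1 poly3 list \<Rightarrow> bool" where
  "GSC fs \<longleftrightarrow> (\<exists>g. saturation_pivot fs g)"

text \<open>\<open>I\<close> is a Cramer ideal with fixed column \<open>(x,y,z)\<^sup>t\<close> and companion \<open>g\<close>, where the remaining
  entries of the matrix are forms of degree \<open>s\<close>.\<close>

definition xyz_cramer :: "nat \<Rightarrow> 'k::comm_ring_1 poly3 set \<Rightarrow> 'k poly3 \<Rightarrow> bool" where
  "xyz_cramer s I g \<longleftrightarrow> (\<exists>\<phi>. \<phi> \<in> carrier_mat 3 3 \<and> forms_mat s \<phi> \<and>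
     g = det \<phi> \<and> nonzerodivisor g \<and> I = cramer_ideal xyz \<phi>)"

section \<open>Minimal graded free resolutions of cyclic modules\<close>

text \<open>The module \<open>F\<^sub>i\<close> is the direct sum of the \<open>R(-a)\<close> for \<open>a\<close> in the list \<open>sh ! i\<close>, with \<open>F\<^sub>0 = R\<close>,
  and the matrix \<open>D ! i\<close> is the differential \<open>F\<^bsub>i+1\<^esub> \<rightarrow> F\<^sub>i\<close>, acting on column vectors. The map
  \<open>R(-b) \<rightarrow> R(-a)\<close> given by a form is homogeneous of degree \<open>0\<close> iff the form has degree \<open>b - a\<close>.
  \<open>res_image sh D i\<close> is the image of \<open>F\<^bsub>i+1\<^esub>\<close> in \<open>F\<^sub>i\<close>, with \<open>F\<^bsub>i+1\<^esub> = 0\<close> beyond the end.\<close>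

definition res_image ::
  "int list list \<Rightarrow> 'k::comm_ring_1 poly3 mat list \<Rightarrow> nat \<Rightarrow> 'k poly3 vec set" where
  "res_image sh D i =
     (if i < length D then (\<lambda>v. D ! i *\<^sub>v v) ` carrier_vec (dim_col (D ! i))
      else {0\<^sub>v (length (sh ! i))})"

definition min_graded_free_resolution ::
  "'k::comm_ring_1 poly3 set \<Rightarrow> int list list \<Rightarrow> 'k poly3 mat list \<Rightarrow> bool" where
  "min_graded_free_resolution I sh D \<longleftrightarrow>
     length sh = Suc (length D) \<and> sh ! 0 = [0] \<and>
     (\<forall>i<length D.
        D ! i \<in> carrier_mat (length (sh ! i)) (length (sh ! Suc i)) \<and>
        (\<forall>r<length (sh ! i). \<forall>c<length (sh ! Suc i).
           form (sh ! Suc i ! c - sh ! i ! r) (D ! i $$ (r, c)) \<and>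
           D ! i $$ (r, c) \<in> irrelevant)) \<and>
     res_image sh D 0 = {v \<in> carrier_vec 1. v $ 0 \<in> I} \<and>
     (\<forall>i<length D. mat_kernel (D ! i) = res_image sh D (Suc i))"

end

theory Submission
  imports Defs "Berlekamp_Zassenhaus.Unique_Factorization_Poly" "HOL-Library.Product_Plus"
begin

text \<open>Write \<open>X\<close> for the column of the three variables. For a 3 by 3 matrix \<open>A\<close> put \<open>D = adj A \<cdot> X\<close>. By Cramer's
rule \<open>A D = (det A) X\<close>, and up to sign the maximal minors of \<open>[X | A]\<close> are \<open>det A\<close> and the entries
of \<open>D\<close>; so \<open>D\<close> generates the Cramer ideal of \<open>A\<close>, with companion \<open>det A\<close>.

The engine is a form of the Hilbert--Burch theorem (\<open>syzygy_of_minors\<close>): if \<open>det A \<noteq> 0\<close> and no prime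
element divides all four minors, then every relation between the minors is a combination of the rows
of \<open>[X | A]\<close>. Indeed \<open>det A\<close> times a relation is such a combination by Cramer's rule, and in a factorial
ring the factor \<open>det A\<close> can be removed again, prime by prime. The codimension enters
through the absence of common prime factors: a prime ideal generated by a prime element has
height at most one (\<open>no_common_prime_of_codim\<close>). Together with the exactness of the Koszul complex of
\<open>x, y, z\<close>, the syzygy theorem shows that the ideal \<open>(D, det A)\<close> is saturated (\<open>minors_saturated\<close>) and that
the kernel of the row \<open>D\<close> is the image of the transpose of \<open>A\<close> after the Koszul map, which gives the
resolution (\<open>resolution_of_cramer_ideal\<close>). Since \<open>(det A) X = A D\<close>, multiplication by \<open>x, y, z\<close> carries
\<open>det A\<close> into \<open>(D)\<close>, so \<open>(D, det A)\<close> is the saturation of \<open>(D)\<close> (\<open>saturation_cramer_ideal\<close>).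

Given a pivot \<open>g\<close> with \<open>A f = g X\<close>, multiplying by the adjugate gives \<open>(det A) f = g D\<close>. The minors have no
common prime factor, hence \<open>det A\<close> divides \<open>g\<close> and \<open>f = q D\<close>, \<open>g = q det A\<close>; and \<open>q\<close> is a constant because
\<open>f\<close> generates an ideal of codimension two. A cube root of \<open>q\<close> is absorbed into \<open>A\<close>
(\<open>pivot_is_maximal_minor\<close>). With entries of degree \<open>s\<close> this forces \<open>d = 2s + 1\<close> and \<open>deg g = 3s\<close>, and all
numerical claims follow, the quotient \<open>I\<^sup>s\<^sup>a\<^sup>t/I\<close> being spanned by the class of \<open>g\<close>.

Conversely, let \<open>I\<close> be the Cramer ideal of \<open>A\<close> and \<open>f\<close> any minimal generating triple of forms of degree
\<open>d\<close>. Then \<open>D\<close> and \<open>f\<close> have the same degree, so they differ by an invertible constant matrix \<open>Q\<close>, with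
\<open>D = Q f\<close>, and \<open>A Q\<close> yields a content matrix for \<open>f\<close>. Its minors generate an ideal between \<open>I\<close> and
\<open>(I, g)\<close>, which has codimension two again: a prime of height two over \<open>I\<close> does not contain all of
\<open>x, y, z\<close>, as these generate an ideal of height at least three, so it contains everything
that they multiply into \<open>I\<close> (\<open>codim_2_of_killed_by_irrelevant\<close>).\<close>

section \<open>Prime elements and codimension in a factorial domain\<close>

(* As a rewrite rule it would turn every prime_elem into irreducible, hiding the divisibility
   property of prime elements from automation. *)

declare prime_elem_iff_irreducible [iff del]

lemmas ideal_defs = is_ideal_def ideal_gen_def

lemma is_ideal_gen: "is_ideal (ideal_gen S)"
  by (simp add: ideal_defs Modules.module.subspace_span[OF module_times])

lemma ideal_gen_base: "a \<in> S \<Longrightarrow> a \<in> ideal_gen S"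
  by (simp add: ideal_defs Modules.module.span_base[OF module_times])

lemma ideal_gen_least: "is_ideal J \<Longrightarrow> S \<subseteq> J \<Longrightarrow> ideal_gen S \<subseteq> J"
  by (simp add: ideal_defs Modules.module.span_minimal[OF module_times])

lemma ideal_zero: "is_ideal J \<Longrightarrow> 0 \<in> J"
  by (simp add: ideal_defs Modules.module.subspace_0[OF module_times])

lemma ideal_add: "is_ideal J \<Longrightarrow> a \<in> J \<Longrightarrow> b \<in> J \<Longrightarrow> a + b \<in> J"
  by (simp add: ideal_defs Modules.module.subspace_add[OF module_times])

lemma ideal_diff: "is_ideal J \<Longrightarrow> a \<in> J \<Longrightarrow> b \<in> J \<Longrightarrow> a - b \<in> J"
  by (simp add: ideal_defs Modules.module.subspace_diff[OF module_times])

lemma ideal_uminus: "is_ideal J \<Longrightarrow> a \<in> J \<Longrightarrow> - a \<in> J"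
  by (simp add: ideal_defs Modules.module.subspace_neg[OF module_times])

lemma ideal_mult: "is_ideal J \<Longrightarrow> a \<in> J \<Longrightarrow> r * a \<in> J"
  by (simp add: ideal_defs Modules.module.subspace_scale[OF module_times])

lemma ideal_mult': "is_ideal J \<Longrightarrow> a \<in> J \<Longrightarrow> a * r \<in> J"
  by (metis ideal_mult mult.commute)

lemma is_idealI:
  assumes "0 \<in> J" and "\<And>a b. a \<in> J \<Longrightarrow> b \<in> J \<Longrightarrow> a + b \<in> J" and "\<And>r a. a \<in> J \<Longrightarrow> r * a \<in> J"
  shows "is_ideal J"
  using assms by (simp add: ideal_defs Modules.module.subspace_def[OF module_times])

lemma ideal_gen_eqI: "S \<subseteq> ideal_gen T \<Longrightarrow> T \<subseteq> ideal_gen S \<Longrightarrow> ideal_gen S = ideal_gen T"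
  by (meson ideal_gen_least is_ideal_gen subset_antisym)

lemma ideal_gen_mono: "S \<subseteq> T \<Longrightarrow> ideal_gen S \<subseteq> ideal_gen T"
  by (simp add: ideal_defs Modules.module.span_mono[OF module_times])

lemma ideal_gen_insert: "h \<in> ideal_gen (insert a S) \<longleftrightarrow> (\<exists>r. h - r * a \<in> ideal_gen S)"
  by (simp add: ideal_defs Modules.module.span_insert[OF module_times])

lemma ideal_gen_empty: "ideal_gen {} = {0}"
  by (simp add: ideal_defs Modules.module.span_empty[OF module_times])

lemma ideal_gen_3: "h \<in> ideal_gen {a, b, c} \<longleftrightarrow> (\<exists>r s t. h = r * a + s * b + t * c)"
  by (auto simp: ideal_gen_insert ideal_gen_empty algebra_simps)

lemma prime_ideal_is_ideal: "is_prime_ideal P \<Longrightarrow> is_ideal P"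
  by (simp add: is_prime_ideal_def)

lemma is_ideal_multiples: "is_ideal {a. q dvd a}"
  by (rule is_idealI) auto

lemma is_prime_ideal_multiples: "prime_elem p \<Longrightarrow> is_prime_ideal {a. p dvd a}"
  unfolding is_prime_ideal_def prime_elem_def
  by (auto simp: is_ideal_multiples set_eq_iff)

lemma ex_prime_elem_dvd:
  fixes q :: "'a::ufd"
  assumes "\<not> q dvd 1"
  shows "q = 0 \<or> (\<exists>p. prime_elem p \<and> p dvd q)"
proof (cases "q = 0")
  case False
  with assms obtain F where F: "mset_factors F q"
    using mset_factors_exist by blast
  then obtain p where p: "p \<in># F" by (auto simp: mset_factors_def)
  then have "p dvd q" "irreducible p" using F by (auto simp: mset_factors_def dvd_prod_mset)
  then show ?thesis by (auto simp: prime_elem_iff_irreducible)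
qed simp

text \<open>Split off the prime factors of \<open>a\<close> one at a time: a prime factor fails to divide some element of \<open>S\<close>,
so it divides \<open>v\<close>.\<close>

lemma dvd_of_dvd_mult_all:
  fixes a :: "'a::ufd"
  assumes "\<not> (\<exists>p. prime_elem p \<and> (\<forall>b\<in>S. p dvd b))" "a \<noteq> 0" "\<forall>b\<in>S. a dvd v * b"
  shows "a dvd v"
proof (cases "a dvd 1")
  case True
  then show ?thesis using dvd_trans one_dvd by blast
next
  case False
  with \<open>a \<noteq> 0\<close> obtain F where F: "mset_factors F a"
    using mset_factors_exist by blast
  then have a: "a = prod_mset F" and F: "\<forall>p\<in>#F. prime_elem p"
    by (auto simp: mset_factors_def prime_elem_iff_irreducible)
  have "prod_mset F dvd v" using F assms(3) unfolding a
  proof (induction F arbitrary: v)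
    case empty
    then show ?case by simp
  next
    case (add p F)
    have p: "prime_elem p" using add.prems(1) by simp
    have "\<exists>b\<in>S. \<not> p dvd b" using assms(1) p by (simp add: Bex_def)
    then obtain b where b: "b \<in> S" "\<not> p dvd b" by (rule bexE)
    have "p dvd prod_mset (add_mset p F)" by simp
    also have "\<dots> dvd v * b" using add.prems(2) b(1) by (rule bspec)
    finally have "p dvd v * b" .
    then obtain w where w: "v = p * w"
      using prime_elem_dvd_multD[OF p] b(2) by (auto simp: dvd_def)
    have p0: "p \<noteq> 0" using p by (simp add: prime_elem_def)
    have "prod_mset F dvd w * b" if "b \<in> S" for b
    proof -
      have "p * prod_mset F dvd p * (w * b)"
        using bspec[OF add.prems(2) that] unfolding w prod_mset.add_mset mult.assoc .
      then show ?thesis using p0 by (metis dvd_mult_cancel_left)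
    qed
    then have "\<forall>b\<in>S. prod_mset F dvd w * b" by (rule ballI)
    moreover have "\<forall>p\<in>#F. prime_elem p" using add.prems(1) by simp
    ultimately have "prod_mset F dvd w" using add.IH by iprover
    then show ?case by (simp add: w)
  qed
  then show ?thesis by (simp add: a)
qed

lemma codim_le: "is_prime_ideal P \<Longrightarrow> J \<subseteq> P \<Longrightarrow> codim J \<le> prime_height P"
  unfolding codim_def by (rule Inf_lower) auto

lemma codim_mono: "I \<subseteq> J \<Longrightarrow> codim I \<le> codim J"
  unfolding codim_def by (rule Inf_superset_mono) auto

lemma codim_attained:
  assumes "codim I = enat n"
  obtains P where "is_prime_ideal P" "I \<subseteq> P" "prime_height P = enat n"
proof -
  let ?A = "{prime_height P | P. is_prime_ideal P \<and> I \<subseteq> P}"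
  have ne: "?A \<noteq> {}"
  proof
    assume "?A = {}"
    then have "codim I = \<infinity>" unfolding codim_def by (simp add: Inf_enat_def)
    then show False using assms by simp
  qed
  then have "Inf ?A \<in> ?A" unfolding Inf_enat_def by (metis (mono_tags, lifting) LeastI ex_in_conv)
  then show ?thesis using that assms unfolding codim_def by auto
qed

lemma prime_height_ge:
  assumes "\<forall>i\<le>n. is_prime_ideal (c i)" "\<forall>i<n. c i \<subset> c (Suc i)" "c n = P"
  shows "enat n \<le> prime_height P"
  unfolding prime_height_def using assms by (intro Sup_upper) auto

lemma prime_ideal_prod_mset:
  assumes Q: "is_prime_ideal Q" and "prod_mset F \<in> Q"
  shows "\<exists>q. q \<in># F \<and> q \<in> Q"
  using assms(2)
proof (induction F)
  case empty
  then have "Q = UNIV"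
    using Q ideal_mult[OF prime_ideal_is_ideal[OF Q], of 1] by auto
  then show ?case using Q by (simp add: is_prime_ideal_def)
next
  case (add q F)
  then show ?case using Q unfolding is_prime_ideal_def by auto
qed

text \<open>A nonzero element of \<open>Q\<close> has a prime factor \<open>q\<close> in \<open>Q\<close>, and \<open>p\<close> divides \<open>q\<close>; the two are then associated,
so \<open>p\<close> would lie in \<open>Q\<close>.\<close>

lemma zero_of_subset_principal:
  fixes p :: "'a::ufd"
  assumes p: "prime_elem p" and Q: "is_prime_ideal Q" "Q \<subset> {a. p dvd a}"
  shows "Q = {0}"
proof -
  have "p \<notin> Q"
  proof
    assume "p \<in> Q"
    then have "{a. p dvd a} \<subseteq> Q"
      using Q(1) by (auto simp: dvd_def intro: ideal_mult' prime_ideal_is_ideal)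
    then show False using Q(2) by blast
  qed
  have "a = 0" if a: "a \<in> Q" for a
  proof (rule ccontr)
    assume "a \<noteq> 0"
    have "\<not> a dvd 1"
      using a Q(1) ideal_mult'[OF prime_ideal_is_ideal[OF Q(1)] a]
      by (auto simp: is_prime_ideal_def dvd_def) (metis ideal_mult mult.right_neutral UNIV_eq_I)
    then obtain F where F: "mset_factors F a" using mset_factors_exist \<open>a \<noteq> 0\<close> by blast
    then have "prod_mset F \<in> Q" using a by (simp add: mset_factors_def)
    then obtain q where q: "q \<in># F" "q \<in> Q" using prime_ideal_prod_mset Q(1) by blast
    then have "irreducible q" using F by (simp add: mset_factors_def)
    moreover have "p dvd q" using q Q(2) by blast
    moreover have "\<not> p dvd 1" using p by (simp add: prime_elem_def)
    ultimately have "q dvd p" using irreducibleD' by blast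
    then have "p \<in> Q" using q(2) Q(1) by (auto simp: dvd_def intro: ideal_mult' prime_ideal_is_ideal)
    with \<open>p \<notin> Q\<close> show False ..
  qed
  then show ?thesis using Q(1) ideal_zero prime_ideal_is_ideal by blast
qed

lemma prime_height_principal_le:
  fixes p :: "'a::ufd"
  assumes p: "prime_elem p"
  shows "prime_height {a. p dvd a} \<le> 1"
  unfolding prime_height_def
proof (rule Sup_least, clarify)
  fix n :: nat and c :: "nat \<Rightarrow> 'a set"
  assume c: "\<forall>i\<le>n. is_prime_ideal (c i)" "\<forall>i<n. c i \<subset> c (Suc i)" "c n = {a. p dvd a}"
  show "enat n \<le> 1"
  proof (rule ccontr)
    assume "\<not> enat n \<le> 1"
    then have n: "n \<ge> 2" by (simp add: one_enat_def)
    then obtain k where k: "n = Suc (Suc k)" by (metis add_2_eq_Suc le_Suc_ex)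
    have "c (Suc k) = {0}"
      using zero_of_subset_principal[OF p, of "c (Suc k)"] c k by (metis Suc_n_not_le_n lessI nat_le_linear)
    then have "c k \<subset> {0}" using c k by (metis less_Suc_eq)
    then have "c k = {}" by blast
    moreover have "is_prime_ideal (c k)" using c(1) k by simp
    ultimately show False using ideal_zero prime_ideal_is_ideal by blast
  qed
qed

lemma no_common_prime_of_codim:
  fixes J :: "'a::ufd set"
  assumes "codim J \<ge> 2"
  shows "\<not> (\<exists>p. prime_elem p \<and> (\<forall>b\<in>J. p dvd b))"
proof
  assume "\<exists>p. prime_elem p \<and> (\<forall>b\<in>J. p dvd b)"
  then obtain p where p: "prime_elem p" "J \<subseteq> {a. p dvd a}" by (auto simp: subset_iff)
  have "codim J \<le> 1"
    by (rule order_trans[OF codim_le[OF is_prime_ideal_multiples p(2)] prime_height_principal_le])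
      (rule p)+
  with assms have "(2::enat) \<le> 1" by (rule order_trans)
  then show False by (simp add: numeral_eq_enat one_enat_def)
qed

section \<open>Vectors and matrices of size three\<close>

text \<open>Vectors are triples and a matrix is the triple of its rows; with this encoding the polynomial
identities between entries become plain computations.\<close>

type_synonym 'a triple = "'a \<times> 'a \<times> 'a"

fun dot :: "'a::comm_ring_1 triple \<Rightarrow> 'a triple \<Rightarrow> 'a" where
  "dot (a1, a2, a3) (b1, b2, b3) = a1 * b1 + a2 * b2 + a3 * b3"

fun cross :: "'a::comm_ring_1 triple \<Rightarrow> 'a triple \<Rightarrow> 'a triple" where
  "cross (a1, a2, a3) (b1, b2, b3) = (a2 * b3 - a3 * b2, a3 * b1 - a1 * b3, a1 * b2 - a2 * b1)"

fun scale :: "'a::comm_ring_1 \<Rightarrow> 'a triple \<Rightarrow> 'a triple" where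
  "scale r (a1, a2, a3) = (r * a1, r * a2, r * a3)"

fun entries :: "'a triple \<Rightarrow> 'a set" where
  "entries (a1, a2, a3) = {a1, a2, a3}"

fun mv :: "'a::comm_ring_1 triple triple \<Rightarrow> 'a triple \<Rightarrow> 'a triple" where
  "mv (r1, r2, r3) v = (dot r1 v, dot r2 v, dot r3 v)"

text \<open>The transposed matrix applied to a vector, that is, a combination of the rows.\<close>

fun tmv :: "'a::comm_ring_1 triple triple \<Rightarrow> 'a triple \<Rightarrow> 'a triple" where
  "tmv (r1, r2, r3) (a1, a2, a3) = scale a1 r1 + scale a2 r2 + scale a3 r3"

fun mm :: "'a::comm_ring_1 triple triple \<Rightarrow> 'a triple triple \<Rightarrow> 'a triple triple" where
  "mm (r1, r2, r3) B = (tmv B r1, tmv B r2, tmv B r3)"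

fun det3 :: "'a::comm_ring_1 triple triple \<Rightarrow> 'a" where
  "det3 (r1, r2, r3) = dot r1 (cross r2 r3)"

text \<open>The rows of the cofactor matrix, the transpose of the adjugate.\<close>

fun cofactors :: "'a::comm_ring_1 triple triple \<Rightarrow> 'a triple triple" where
  "cofactors (r1, r2, r3) = (cross r2 r3, cross r3 r1, cross r1 r2)"

text \<open>The product of the adjugate with the column \<open>X\<close>: the numerators in Cramer's rule.\<close>

definition cramer :: "'a::comm_ring_1 triple triple \<Rightarrow> 'a triple \<Rightarrow> 'a triple" where
  "cramer A X = tmv (cofactors A) X"

lemma triple_triple_cases:
  obtains a1 a2 a3 b1 b2 b3 c1 c2 c3 where "A = ((a1, a2, a3), (b1, b2, b3), (c1, c2, c3))"
  by (metis prod_cases3)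

lemma dot_commute: "dot u v = dot v u"
  by (cases u rule: prod_cases3; cases v rule: prod_cases3) (simp add: mult.commute)

lemma dot_linear:
  "dot (u + v) w = dot u w + dot v w" "dot (u - v) w = dot u w - dot v w"
  "dot (scale r u) w = r * dot u w" "dot w (scale r u) = r * dot w u" "dot 0 w = 0"
  by (cases u rule: prod_cases3; cases v rule: prod_cases3; cases w rule: prod_cases3; simp add: algebra_simps zero_prod_def)+

lemma scale_simps:
  "scale r (u + v) = scale r u + scale r v" "scale r (u - v) = scale r u - scale r v"
  "scale r (scale s u) = scale (r * s) u" "scale 1 u = u" "scale r 0 = 0" "scale 0 u = 0"
  "scale r (- u) = - scale r u" "scale (- r) u = - scale r u"
  by (cases u rule: prod_cases3; cases v rule: prod_cases3; simp add: algebra_simps zero_prod_def)+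

lemma scale_cancel:
  fixes r :: "'a::idom"
  shows "scale r u = scale r v \<longleftrightarrow> r = 0 \<or> u = v"
  by (cases u rule: prod_cases3; cases v rule: prod_cases3) auto

lemma tmv_linear:
  "tmv A (u + v) = tmv A u + tmv A v" "tmv A (u - v) = tmv A u - tmv A v"
  "tmv A (scale r u) = scale r (tmv A u)" "tmv A 0 = 0"
  by (cases A rule: triple_triple_cases; cases u rule: prod_cases3; cases v rule: prod_cases3;
      auto simp: algebra_simps zero_prod_def)+

lemma mv_linear:
  "mv A (scale r u) = scale r (mv A u)" "mv A 0 = 0"
  by (cases A rule: triple_triple_cases; cases u rule: prod_cases3; simp add: algebra_simps zero_prod_def)+

lemma cross_linear:
  "cross w (u + v) = cross w u + cross w v" "cross w (u - v) = cross w u - cross w v"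
  "cross w (scale r u) = scale r (cross w u)"
  "cross (u + v) w = cross u w + cross v w" "cross (scale r u) w = scale r (cross u w)"
  by (cases u rule: prod_cases3; cases v rule: prod_cases3; cases w rule: prod_cases3;
      simp add: algebra_simps)+

lemma cross_self: "cross u u = 0"
  by (cases u rule: prod_cases3) (simp add: zero_prod_def mult.commute)

lemma cross_cross: "cross u (cross v w) = scale (dot u w) v - scale (dot u v) w"
  by (cases u rule: prod_cases3; cases v rule: prod_cases3; cases w rule: prod_cases3) (simp add: algebra_simps)

lemma dot_cross: "dot u (cross u v) = 0"
  by (cases u rule: prod_cases3; cases v rule: prod_cases3) (simp add: algebra_simps)

lemma dot_tmv: "dot (tmv A a) v = dot a (mv A v)"
  by (cases A rule: triple_triple_cases; cases a rule: prod_cases3; cases v rule: prod_cases3)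
    (simp add: algebra_simps)

lemma entries_scale: "entries (scale r v) = (*) r ` entries v"
  by (cases v rule: prod_cases3) simp

lemma entries_mv: "entries (mv A u) = (\<lambda>r. dot r u) ` entries A"
  by (cases A rule: prod_cases3) simp

lemma mv_mm: "mv (mm A B) v = mv A (mv B v)"
  by (cases A) (simp add: dot_tmv)

lemma mv_cramer: "mv A (cramer A X) = scale (det3 A) X"
  by (cases A rule: triple_triple_cases; cases X rule: prod_cases3) (simp add: cramer_def algebra_simps)

lemma cramer_mv: "cramer A (mv A v) = scale (det3 A) v"
  by (cases A rule: triple_triple_cases; cases v rule: prod_cases3) (simp add: cramer_def algebra_simps)

lemma tmv_cofactors: "tmv A (mv (cofactors A) u) = scale (det3 A) u"
  by (cases A rule: triple_triple_cases; cases u rule: prod_cases3) (simp add: algebra_simps)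

lemma mv_cofactors_tmv: "mv (cofactors A) (tmv A u) = scale (det3 A) u"
  by (cases A rule: triple_triple_cases; cases u rule: prod_cases3) (simp add: algebra_simps)

lemma cross_tmv: "cross (tmv B u) (tmv B v) = tmv (cofactors B) (cross u v)"
  by (cases B rule: triple_triple_cases; cases u rule: prod_cases3; cases v rule: prod_cases3)
    (simp add: algebra_simps)

lemma det3_mm: "det3 (mm A B) = det3 A * det3 B"
  by (cases A rule: prod_cases3)
    (simp add: cross_tmv dot_tmv mv_cramer[unfolded cramer_def] dot_linear mult.commute)

lemma cross_cross_cross: "cross (cross u v) (cross v w) = scale (det3 (u, v, w)) v"
  by (cases u rule: prod_cases3; cases v rule: prod_cases3; cases w rule: prod_cases3)
    (simp add: algebra_simps)

lemma det3_rotate: "det3 (v, w, u) = det3 (u, v, w)"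
  by (cases u rule: prod_cases3; cases v rule: prod_cases3; cases w rule: prod_cases3)
    (simp add: algebra_simps)

section \<open>Relations between the maximal minors\<close>

lemma dvd_entries: "(\<forall>a\<in>entries v. q dvd a) \<longleftrightarrow> (\<exists>w. v = scale q w)"
proof
  assume "\<forall>a\<in>entries v. q dvd a"
  then show "\<exists>w. v = scale q w"
    by (cases v rule: prod_cases3) (auto simp: dvd_def split_paired_Ex)
qed (auto split: prod.splits simp: split_paired_Ex)

lemma ideal_gen_insert_entries:
  "h \<in> ideal_gen (insert g (entries v)) \<longleftrightarrow> (\<exists>q t. h = q * g + dot t v)"
proof (cases v rule: prod_cases3)
  case (fields a b c)
  have "h \<in> ideal_gen (insert g (entries v)) \<longleftrightarrow> (\<exists>q r s t. h - q * g = r * a + s * b + t * c)"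
    by (simp add: fields ideal_gen_insert[of _ g] ideal_gen_3)
  also have "\<dots> \<longleftrightarrow> (\<exists>q t. h = q * g + dot t v)"
    by (auto simp: fields split_paired_Ex algebra_simps)
  finally show ?thesis .
qed

lemma ideal_gen_entries: "h \<in> ideal_gen (entries v) \<longleftrightarrow> (\<exists>t. h = dot t v)"
  by (cases v rule: prod_cases3) (simp add: ideal_gen_3 split_paired_Ex)

lemma tmv_inj:
  fixes A :: "'a::idom triple triple"
  assumes "det3 A \<noteq> 0" "tmv A v = tmv A w"
  shows "v = w"
  using assms by (metis mv_cofactors_tmv scale_cancel)

lemma mv_inj:
  fixes A :: "'a::idom triple triple"
  assumes "det3 A \<noteq> 0" "mv A v = mv A w"
  shows "v = w"
  using assms by (metis cramer_mv scale_cancel)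

text \<open>Modulo the determinant the adjugate has rank at most one. Concretely, the difference is
\<open>u \<times> (D \<times> c)\<close> by the triple product expansion, and \<open>D \<times> c\<close> is divisible by the
determinant because the cross product of two rows of cofactors is the determinant times a row.\<close>

lemma cofactor_times_cramer:
  assumes "c \<in> entries (cofactors A)"
  shows "\<exists>w. scale (dot c u) (cramer A X) = scale (dot u (cramer A X)) c + scale (det3 A) w"
proof -
  obtain r1 r2 r3 where A: "A = (r1, r2, r3)" by (cases A)
  obtain x y z where X: "X = (x, y, z)" by (cases X)
  let ?c1 = "cross r2 r3" and ?c2 = "cross r3 r1" and ?c3 = "cross r1 r2"
  let ?g = "det3 A" and ?D = "cramer A X"
  have D: "?D = scale x ?c1 + scale y ?c2 + scale z ?c3"
    by (simp add: cramer_def A X)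
  have anti: "cross a b = - cross b a" for a b :: "'a triple"
    by (cases a; cases b) simp
  have c12: "cross ?c1 ?c2 = scale ?g r3" and c23: "cross ?c2 ?c3 = scale ?g r1"
    and c31: "cross ?c3 ?c1 = scale ?g r2"
    using cross_cross_cross[of r2 r3 r1] cross_cross_cross[of r3 r1 r2] cross_cross_cross[of r1 r2 r3]
      det3_rotate[of r2 r3 r1] det3_rotate[of r3 r1 r2]
    unfolding A by argo+
  note c = c12 c23 c31 anti[of ?c2 ?c1, unfolded c12] anti[of ?c3 ?c2, unfolded c23]
    anti[of ?c1 ?c3, unfolded c31]
  have "cross ?D ?c1 = scale ?g (scale z r2 - scale y r3)"
    "cross ?D ?c2 = scale ?g (scale x r3 - scale z r1)"
    "cross ?D ?c3 = scale ?g (scale y r1 - scale x r2)"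
    unfolding D cross_linear c cross_self by (simp_all add: scale_simps mult.commute)
  moreover have "c = ?c1 \<or> c = ?c2 \<or> c = ?c3"
    using assms by (simp add: A)
  ultimately obtain w where "cross ?D c = scale ?g w" by metis
  then have "cross u (cross ?D c) = scale ?g (cross u w)"
    by (simp add: cross_linear)
  then show ?thesis
    unfolding cross_cross by (intro exI[of _ "cross u w"]) (simp add: dot_commute[of c] diff_eq_eq add.commute)
qed

text \<open>The Hilbert--Burch theorem for \<open>[X | A]\<close>. The only candidate for \<open>a\<close> is the cofactor matrix applied
to \<open>u\<close>, divided by the determinant. Modulo the determinant, its entries multiply every minor to zero, the
minors \<open>D\<close> by the rank one property of the adjugate; without a common prime factor of the minors,
the division is exact.\<close>

lemma syzygy_of_minors:
  fixes A :: "'a::ufd triple triple"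
  assumes g: "det3 A \<noteq> 0"
    and coprime: "\<not> (\<exists>p. prime_elem p \<and> (\<forall>b\<in>insert (det3 A) (entries (cramer A X)). p dvd b))"
    and syz: "p * det3 A + dot u (cramer A X) = 0"
  shows "\<exists>a. u = tmv A a \<and> p = - dot a X"
proof -
  let ?g = "det3 A" and ?D = "cramer A X"
  have "?g dvd b" if b: "b \<in> entries (mv (cofactors A) u)" for b
  proof -
    obtain c where c: "c \<in> entries (cofactors A)" "b = dot c u"
      using b by (auto simp: entries_mv)
    obtain w where w: "scale b ?D = scale (dot u ?D) c + scale ?g w"
      using cofactor_times_cramer c by blast
    have "dot u ?D = ?g * (- p)"
      using syz by (simp add: eq_neg_iff_add_eq_0 algebra_simps)
    then have "scale b ?D = scale ?g (scale (- p) c + w)"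
      by (simp add: w scale_simps)
    then have "\<forall>a\<in>entries (scale b ?D). ?g dvd a"
      unfolding dvd_entries by blast
    then have "\<forall>a\<in>entries ?D. ?g dvd b * a"
      by (cases ?D rule: prod_cases3) auto
    then have "\<forall>a\<in>insert ?g (entries ?D). ?g dvd b * a" by simp
    then show ?thesis using dvd_of_dvd_mult_all[OF coprime g] by blast
  qed
  then have "\<forall>b\<in>entries (mv (cofactors A) u). ?g dvd b" by (rule ballI)
  then obtain a where a: "mv (cofactors A) u = scale ?g a"
    unfolding dvd_entries by (rule exE)
  then have "scale ?g (tmv A a) = scale ?g u"
    using tmv_cofactors[of A u] by (simp add: tmv_linear)
  then have u: "u = tmv A a" using g by (simp add: scale_cancel)
  have "?g * (p + dot a X) = 0"
    using syz by (simp add: u dot_tmv mv_cramer dot_linear algebra_simps)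
  then show ?thesis using g u by (intro exI[of _ a]) (simp add: eq_neg_iff_add_eq_0)
qed

section \<open>The Koszul complex of the variables\<close>

abbreviation vars :: "'k::comm_ring_1 poly3 triple" where
  "vars \<equiv> (var_x, var_y, var_z)"

lemma smult_X_eq_pCons_smult_X:
  fixes a b :: "'a::idom poly poly"
  assumes "smult [:0, 1:] a + pCons 0 b = 0"
  shows "\<exists>e. a = pCons 0 e \<and> b = - smult [:0, 1:] e"
proof (cases a)
  case (pCons c e)
  have "pCons ([:0, 1:] * c) (smult [:0, 1:] e + b) = 0"
    using assms by (simp add: pCons)
  then have "c = 0" "smult [:0, 1:] e + b = 0" by (simp_all del: pCons_0_0)
  then show ?thesis using pCons by (auto simp: eq_neg_iff_add_eq_0 add.commute)
qed

lemma cross_from_remainders: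
  fixes x y z :: "'a::idom"
  assumes "x * (y * c + z * q1) + y * (z * q2 - x * c) + z * v3 = 0" "z \<noteq> 0"
  shows "(y * c + z * q1, z * q2 - x * c, v3) = cross (x, y, z) (q2, - q1, c)"
proof -
  have "z * (v3 - (x * (- q1) - y * q2)) = 0"
    using assms(1) by (simp add: algebra_simps)
  then have "v3 = x * (- q1) - y * q2" using assms(2) by simp
  then show ?thesis by simp
qed

text \<open>Setting \<open>z = 0\<close> leaves a relation between \<open>x\<close> and \<open>y\<close>, which is a multiple \<open>e\<close> of the obvious one; the
quotients by \<open>z\<close> provide the two other coefficients.\<close>

lemma koszul_exact_middle:
  fixes v :: "'k::idom poly3 triple"
  assumes "dot vars v = 0"
  shows "\<exists>w. v = cross vars w"
proof -
  obtain v1 v2 v3 where v: "v = (v1, v2, v3)" by (cases v)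
  obtain p1 q1 p2 q2 where p: "v1 = pCons p1 q1" "v2 = pCons p2 q2"
    by (metis pCons_cases)
  have eq: "var_x * v1 + var_y * v2 + var_z * v3 = 0"
    using assms by (simp add: v)
  then have "smult [:0, 1:] p1 + pCons 0 p2 = 0"
    by (simp add: p)
  then obtain e where e: "p1 = pCons 0 e" "p2 = - smult [:0, 1:] e"
    using smult_X_eq_pCons_smult_X by blast
  have v1: "v1 = var_y * [:e:] + var_z * q1" and v2: "v2 = var_z * q2 - var_x * [:e:]"
    by (simp_all add: p e)
  have "v = cross vars (q2, - q1, [:e:])"
    unfolding v v1 v2 by (rule cross_from_remainders) (use eq v1 v2 in simp_all)
  then show ?thesis ..
qed

lemma koszul_exact_left:
  fixes v :: "'k::idom poly3 triple"
  assumes "cross vars v = 0"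
  shows "\<exists>t. v = scale t vars"
proof -
  obtain v1 v2 v3 where v: "v = (v1, v2, v3)" by (cases v)
  have eq: "var_y * v3 = var_z * v2" "var_z * v1 = var_x * v3"
    using assms by (simp_all add: v zero_prod_def)
  obtain p t where p: "v3 = pCons p t" by (metis pCons_cases)
  have "pCons 0 p = 0" using eq(1) by (simp add: p)
  then have v3: "v3 = var_z * t" by (simp add: p)
  have "var_z * v1 = var_z * (var_x * t)" "var_z * v2 = var_z * (var_y * t)"
    using eq unfolding v3 by (metis mult.left_commute)+
  then have "v1 = var_x * t" "v2 = var_y * t" 
    by (metis mult_cancel_left pCons_eq_0_iff zero_neq_one)+
  then show ?thesis by (intro exI[of _ t]) (simp add: v v3 mult.commute)
qed

text \<open>Exactness in the middle, applied to each of the three entries. Only the first difference is recorded, as the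
argument for saturatedness compares the multiples of \<open>x\<close> and \<open>y\<close>.\<close>

lemma koszul_exact_triples:
  fixes \<alpha> \<beta> \<gamma> :: "'k::idom poly3 triple"
  assumes "scale var_z \<alpha> - scale var_y \<beta> + scale var_x \<gamma> = 0"
  shows "\<exists>a b. \<alpha> = scale var_y a - scale var_x b"
proof -
  have *: "\<exists>a b. p = var_y * a - var_x * b"
    if eq: "var_z * p - var_y * q + var_x * r = 0" for p q r :: "'k poly3"
  proof -
    have "dot vars (r, - q, p) = 0"
      using eq unfolding dot.simps mult_minus_right by (simp del: mult_pCons_left add: algebra_simps)
    then obtain w1 w2 w3 where "(r, - q, p) = cross vars (w1, w2, w3)"
      using koszul_exact_middle by (metis prod_cases3)
    then have "p = var_y * (- w1) - var_x * (- w2)"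
      unfolding cross.simps prod.inject mult_minus_right by (simp del: mult_pCons_left)
    then show ?thesis by blast
  qed
  obtain \<alpha>1 \<alpha>2 \<alpha>3 \<beta>1 \<beta>2 \<beta>3 \<gamma>1 \<gamma>2 \<gamma>3 where
    c: "\<alpha> = (\<alpha>1, \<alpha>2, \<alpha>3)" "\<beta> = (\<beta>1, \<beta>2, \<beta>3)" "\<gamma> = (\<gamma>1, \<gamma>2, \<gamma>3)"
    by (metis prod_cases3)
  have "var_z * \<alpha>1 - var_y * \<beta>1 + var_x * \<gamma>1 = 0" "var_z * \<alpha>2 - var_y * \<beta>2 + var_x * \<gamma>2 = 0"
    "var_z * \<alpha>3 - var_y * \<beta>3 + var_x * \<gamma>3 = 0"
    using assms unfolding c scale.simps minus_prod_def plus_prod_def zero_prod_def prod.inject fst_conv snd_conv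
    by blast+
  from this[THEN *] obtain a1 b1 a2 b2 a3 b3 where
    "\<alpha>1 = var_y * a1 - var_x * b1" "\<alpha>2 = var_y * a2 - var_x * b2" "\<alpha>3 = var_y * a3 - var_x * b3"
    by blast
  then have "\<alpha> = scale var_y (a1, a2, a3) - scale var_x (b1, b2, b3)"
    unfolding c scale.simps minus_prod_def fst_conv snd_conv by blast
  then show ?thesis by blast
qed

lemma var_x_dvd:
  fixes w w' :: "'k::idom poly3"
  assumes "var_y * w = var_x * w'"
  shows "var_x dvd w"
proof -
  have "[:0, 1:] dvd coeff (coeff w k) j" for k j
  proof -
    have "coeff (coeff (var_y * w) k) (Suc j) = coeff (coeff (var_x * w') k) (Suc j)"
      using assms by (rule arg_cong)
    then have "coeff (coeff w k) j = [:0, 1:] * coeff (coeff w' k) (Suc j)" by simp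
    then show ?thesis by (rule dvdI)
  qed
  then show ?thesis by (simp add: const_poly_dvd_iff)
qed

lemma var_x_dvd_entries:
  fixes w w' :: "'k::idom poly3 triple"
  assumes "scale var_y w = scale var_x w'"
  shows "\<forall>b\<in>entries w. var_x dvd b"
proof -
  obtain w1 w2 w3 v1 v2 v3 where w: "w = (w1, w2, w3)" "w' = (v1, v2, v3)"
    by (metis prod_cases3)
  show ?thesis
    using assms var_x_dvd[of w1 v1] var_x_dvd[of w2 v2] var_x_dvd[of w3 v3]
    unfolding w scale.simps prod.inject entries.simps by blast
qed

text \<open>The quotient by the minors has a free resolution of length two in a ring of dimension three, so the
irrelevant ideal is not associated to it. In elementary terms: write \<open>x h\<close>, \<open>y h\<close>, \<open>z h\<close> as combinations of the minors with coefficient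
vectors \<open>U\<^sub>1\<close>, \<open>U\<^sub>2\<close>, \<open>U\<^sub>3\<close>. The differences \<open>y U\<^sub>1 - x U\<^sub>2\<close> and so on are relations, hence combinations of
the rows, and Koszul exactness permits a correction of \<open>U\<^sub>1\<close> and \<open>U\<^sub>2\<close> by combinations of the rows
after which \<open>y U\<^sub>1 = x U\<^sub>2\<close>. Then \<open>x\<close> divides \<open>U\<^sub>1\<close>, and cancelling \<open>x\<close> expresses \<open>h\<close> by the minors.\<close>

lemma minors_saturated:
  fixes A :: "'k::{idom,ufd} poly3 triple triple"
  assumes g: "det3 A \<noteq> 0"
    and coprime: "\<not> (\<exists>p. prime_elem p \<and> (\<forall>b\<in>insert (det3 A) (entries (cramer A vars)). p dvd b))"
    and h: "\<forall>t\<in>{var_x, var_y, var_z}. t * h \<in> ideal_gen (insert (det3 A) (entries (cramer A vars)))"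
  shows "h \<in> ideal_gen (insert (det3 A) (entries (cramer A vars)))"
proof -
  let ?g = "det3 A" and ?D = "cramer A vars"
  obtain p1 u1 p2 u2 p3 u3 where u: "var_x * h = p1 * ?g + dot u1 ?D"
    "var_y * h = p2 * ?g + dot u2 ?D" "var_z * h = p3 * ?g + dot u3 ?D"
    using h unfolding ideal_gen_insert_entries by (metis insertI1 insertI2)
  have syz: "\<exists>a. scale t u - scale s w = tmv A a \<and> t * p - s * q = - dot a vars"
    if "s * h = p * ?g + dot u ?D" "t * h = q * ?g + dot w ?D" for s t p q u w
  proof (rule syzygy_of_minors[OF g coprime])
    have "(t * p - s * q) * ?g + dot (scale t u - scale s w) ?D
        = t * (p * ?g + dot u ?D) - s * (q * ?g + dot w ?D)"
      by (simp only: dot_linear algebra_simps)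
    also have "\<dots> = 0" unfolding that[symmetric] by (simp only: algebra_simps) simp
    finally show "(t * p - s * q) * ?g + dot (scale t u - scale s w) ?D = 0" .
  qed
  obtain \<alpha> where \<alpha>: "scale var_y u1 - scale var_x u2 = tmv A \<alpha>" "var_y * p1 - var_x * p2 = - dot \<alpha> vars"
    using syz[OF u(1,2)] by blast
  obtain \<beta> where \<beta>: "scale var_z u1 - scale var_x u3 = tmv A \<beta>"
    using syz[OF u(1,3)] by blast
  obtain \<gamma> where \<gamma>: "scale var_z u2 - scale var_y u3 = tmv A \<gamma>"
    using syz[OF u(2,3)] by blast
  have "tmv A (scale var_z \<alpha> - scale var_y \<beta> + scale var_x \<gamma>) = tmv A 0"
    unfolding tmv_linear \<alpha>(1)[symmetric] \<beta>[symmetric] \<gamma>[symmetric] scale_simps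
    by (simp only: mult.commute[of var_y var_z] mult.commute[of var_x var_z] mult.commute[of var_x var_y]) simp
  then have "scale var_z \<alpha> - scale var_y \<beta> + scale var_x \<gamma> = 0"
    by (rule tmv_inj[OF g])
  then obtain a b where ab: "\<alpha> = scale var_y a - scale var_x b"
    using koszul_exact_triples by blast
  \<comment> \<open>The corrected coefficient vectors, first their last three entries and then the one of \<open>det A\<close>.\<close>
  have "scale var_y (u1 - tmv A a) = scale var_x (u2 - tmv A b)"
    using \<alpha>(1) unfolding ab tmv_linear scale_simps by (simp add: algebra_simps)
  then have "\<forall>b\<in>entries (u1 - tmv A a). var_x dvd b"
    by (rule var_x_dvd_entries)
  moreover have "var_y * (p1 + dot a vars) = var_x * (p2 + dot b vars)"
  proof -
    have "y * (p1 + c) = x * (p2 + d)" if "y * p1 - x * p2 = - (y * c - x * d)" for x y c d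
      using that by (simp add: algebra_simps)
    then show ?thesis using \<alpha>(2) unfolding ab dot_linear .
  qed
  then have "var_x dvd p1 + dot a vars" by (rule var_x_dvd)
  ultimately obtain q t where q: "p1 + dot a vars = var_x * q" and t: "u1 - tmv A a = scale var_x t"
    unfolding dvd_entries by (meson dvdE)
  have "var_x * h = (var_x * q - dot a vars) * ?g + dot (tmv A a + scale var_x t) ?D"
    unfolding u(1) q[symmetric] t[symmetric] by (simp add: algebra_simps)
  also have "\<dots> = var_x * (q * ?g + dot t ?D)"
  proof -
    have "(x * q - c) * e + (e * c + x * d) = x * (q * e + d)" for x q c d e :: "'k poly3"
      by (simp add: algebra_simps)
    then show ?thesis unfolding dot_linear dot_tmv mv_cramer .
  qed
  finally have "h = q * ?g + dot t ?D"
    by (rule mult_left_cancel[THEN iffD1, rotated]) simp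
  then show ?thesis unfolding ideal_gen_insert_entries by (intro exI)
qed

section \<open>Forms and homogeneous components\<close>

lemma poly3_eqI: "(\<And>i j k. coeff3 f i j k = coeff3 g i j k) \<Longrightarrow> f = g"
  by (simp add: coeff3_def poly_eq_iff)

lemma coeff3_simps [simp]:
  "coeff3 0 i j k = 0" "coeff3 (f + g) i j k = coeff3 f i j k + coeff3 g i j k"
  "coeff3 (f - g) i j k = coeff3 f i j k - coeff3 g i j k" "coeff3 (- f) i j k = - coeff3 f i j k"
  by (simp_all add: coeff3_def)

lemma coeff3_mult:
  "coeff3 (f * g) i j k =
    (\<Sum>k'\<le>k. \<Sum>j'\<le>j. \<Sum>i'\<le>i. coeff3 f i' j' k' * coeff3 g (i - i') (j - j') (k - k'))"
  by (simp add: coeff3_def coeff_mult coeff_sum)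

lemma coeff3_form_eq_0: "form (int d) f \<Longrightarrow> i + j + k \<noteq> d \<Longrightarrow> coeff3 f i j k = 0"
  unfolding form_def of_nat_eq_iff by blast

lemma form_0 [simp]: "form e 0"
  by (simp add: form_def)

lemma form_add: "form e f \<Longrightarrow> form e g \<Longrightarrow> form e (f + g)"
  unfolding form_def by (metis add.right_neutral coeff3_simps(2))

lemma form_uminus: "form e f \<Longrightarrow> form e (- f)"
  by (simp add: form_def)

lemma form_diff: "form e f \<Longrightarrow> form e g \<Longrightarrow> form e (f - g)"
  using form_add[of e f "- g"] form_uminus[of e g] by simp

lemma form_mult:
  assumes "form d f" "form e g"
  shows "form (d + e) (f * g)"
  unfolding form_def
proof (intro allI impI)
  fix i j k assume "coeff3 (f * g) i j k \<noteq> 0"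
  then obtain i' j' k' where le: "i' \<le> i" "j' \<le> j" "k' \<le> k"
    and "coeff3 f i' j' k' * coeff3 g (i - i') (j - j') (k - k') \<noteq> 0"
    unfolding coeff3_mult by (metis (no_types, lifting) atMost_iff sum.neutral)
  then have "coeff3 f i' j' k' \<noteq> 0" "coeff3 g (i - i') (j - j') (k - k') \<noteq> 0" by auto
  then have "int (i' + j' + k') = d" "int ((i - i') + (j - j') + (k - k')) = e"
    using assms unfolding form_def by blast+
  then show "int (i + j + k) = d + e" using le by linarith
qed

lemma form_vars: "form 1 var_x" "form 1 var_y" "form 1 var_z"
  by (auto simp: form_def coeff3_def coeff_pCons split: nat.splits if_splits)

lemma coeff3_const: "coeff3 [:[:[:c:]:]:] i j k = (if i = 0 \<and> j = 0 \<and> k = 0 then c else 0)"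
  by (auto simp: coeff3_def coeff_pCons split: nat.splits)

lemma form_const: "form 0 [:[:[:c:]:]:]"
  by (simp add: form_def coeff3_const)

lemma form_degree_unique: "form d f \<Longrightarrow> form e f \<Longrightarrow> f \<noteq> 0 \<Longrightarrow> d = e"
  unfolding form_def by (metis coeff3_simps(1) poly3_eqI)

lemma form_0_eq_const:
  assumes "form 0 f"
  shows "f = [:[:[:coeff3 f 0 0 0:]:]:]"
proof (rule poly3_eqI)
  fix i j k
  show "coeff3 f i j k = coeff3 [:[:[:coeff3 f 0 0 0:]:]:] i j k"
    using coeff3_form_eq_0[of 0 f i j k] assms by (auto simp: coeff3_const)
qed

lemma form_0_unit:
  fixes f :: "'k::field poly3"
  assumes "form 0 f" "f \<noteq> 0"
  shows "\<exists>u. form 0 u \<and> u * f = 1"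
proof -
  obtain c where f: "f = [:[:[:c:]:]:]" by (rule that[OF form_0_eq_const[OF assms(1)]])
  then have "[:[:[:inverse c:]:]:] * f = 1" using assms(2) by simp
  then show ?thesis using form_const by blast
qed

lemma total_deg_form:
  assumes f: "form (int e) f" "f \<noteq> 0"
  shows "total_deg f = e"
proof -
  have "\<exists>i j k. coeff3 f i j k \<noteq> 0"
  proof (rule ccontr)
    assume "\<nexists>i j k. coeff3 f i j k \<noteq> 0"
    then have "f = 0" by (intro poly3_eqI) simp
    with f(2) show False ..
  qed
  moreover have "i + j + k = e" if "coeff3 f i j k \<noteq> 0" for i j k
    using f(1) that unfolding form_def of_nat_eq_iff by simp
  ultimately have "{i + j + k | i j k. coeff3 f i j k \<noteq> 0} = {e}" by blast
  then show ?thesis using f(2) by (simp add: total_deg_def)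
qed

lemma irrelevant_iff: "f \<in> irrelevant \<longleftrightarrow> coeff3 f 0 0 0 = 0"
proof
  assume "f \<in> irrelevant"
  then show "coeff3 f 0 0 0 = 0"
    by (auto simp: irrelevant_def ideal_gen_3 coeff3_mult, simp add: coeff3_def)
next
  assume 0: "coeff3 f 0 0 0 = 0"
  obtain a b where f: "f = pCons a b" by (cases f)
  obtain c d where a: "a = pCons c d" by (cases a)
  obtain r s where c: "c = pCons r s" by (cases c)
  have "r = 0" using 0 by (simp add: f a c coeff3_def)
  then have "f = [:[:s:]:] * var_x + [:d:] * var_y + b * var_z"
    by (simp add: f a c)
  then show "f \<in> irrelevant" unfolding irrelevant_def ideal_gen_3 by blast
qed

lemma form_irrelevant:
  assumes "form e f" "e \<noteq> 0"
  shows "f \<in> irrelevant"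
  using assms by (force simp: irrelevant_iff form_def)

text \<open>The homogeneous component of degree \<open>n\<close>.\<close>

definition hcomp :: "nat \<Rightarrow> 'k::comm_ring_1 poly3 \<Rightarrow> 'k poly3" where
  "hcomp n f = (\<Sum>k\<le>n. monom (\<Sum>j\<le>n. monom (\<Sum>i\<le>n.
     monom (if i + j + k = n then coeff3 f i j k else 0) i) j) k)"

lemma coeff3_hcomp: "coeff3 (hcomp n f) i j k = (if i + j + k = n then coeff3 f i j k else 0)"
proof -
  have coeff_sum_monom: "coeff (\<Sum>k\<le>n. monom (F k) k) m = (if m \<le> n then F m else 0)"
    for F :: "nat \<Rightarrow> 'b::comm_monoid_add" and m
    by (simp add: coeff_sum)
  show ?thesis
    by (auto simp: coeff3_def hcomp_def coeff_sum_monom)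
qed

lemma hcomp_add: "hcomp n (f + g) = hcomp n f + hcomp n g"
  by (rule poly3_eqI) (simp add: coeff3_hcomp)

lemma form_hcomp: "form (int n) (hcomp n f)"
  by (auto simp: form_def coeff3_hcomp)

lemma hcomp_form: "form (int d) f \<Longrightarrow> hcomp n f = (if n = d then f else 0)"
  by (rule poly3_eqI) (simp add: coeff3_hcomp coeff3_form_eq_0)

lemma hcomp_mult_form:
  assumes f: "form (int d) f"
  shows "hcomp n (r * f) = (if d \<le> n then hcomp (n - d) r * f else 0)"
proof (rule poly3_eqI)
  fix i j k
  have deg: "coeff3 f (i - i') (j - j') (k - k') = 0"
    if "i' \<le> i" "j' \<le> j" "k' \<le> k" "i + j + k \<noteq> d + (i' + j' + k')" for i' j' k'
    using f that by (intro coeff3_form_eq_0) auto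
  show "coeff3 (hcomp n (r * f)) i j k = coeff3 (if d \<le> n then hcomp (n - d) r * f else 0) i j k"
  proof (cases "d \<le> n")
    case True
    have "coeff3 (hcomp (n - d) r) i' j' k' * coeff3 f (i - i') (j - j') (k - k') =
        (if i + j + k = n then coeff3 r i' j' k' * coeff3 f (i - i') (j - j') (k - k') else 0)"
      if "i' \<le> i" "j' \<le> j" "k' \<le> k" for i' j' k'
      using deg[OF that] True by (cases "i + j + k = d + (i' + j' + k')") (auto simp: coeff3_hcomp)
    then show ?thesis using True
      by (simp add: coeff3_hcomp coeff3_mult)
  next
    case False
    have "coeff3 r i' j' k' * coeff3 f (i - i') (j - j') (k - k') = 0"
      if "i + j + k = n" "i' \<le> i" "j' \<le> j" "k' \<le> k" for i' j' k'
      using deg[OF that(2-4)] that False by auto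
    then show ?thesis using False by (simp add: coeff3_hcomp coeff3_mult)
  qed
qed

lemma hcomp_dot_forms:
  assumes "\<forall>f\<in>entries v. form (int d) f"
  shows "\<exists>c. hcomp n (dot t v) = dot c v \<and> (n = d \<longrightarrow> (\<forall>a\<in>entries c. form 0 a)) \<and> (n < d \<longrightarrow> c = 0)"
proof -
  obtain t1 t2 t3 v1 v2 v3 where tv: "t = (t1, t2, t3)" "v = (v1, v2, v3)"
    by (metis prod_cases3)
  define c where "c a = (if d \<le> n then hcomp (n - d) a else 0)" for a :: "'a poly3"
  have "hcomp n (dot t v) = dot (c t1, c t2, c t3) v"
    using assms by (auto simp: tv hcomp_add hcomp_mult_form[of d v1] hcomp_mult_form[of d v2]
      hcomp_mult_form[of d v3] c_def)
  moreover have "\<forall>a\<in>entries (c t1, c t2, c t3). form 0 a" if "n = d"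
    using that form_hcomp[of 0] by (auto simp: c_def)
  moreover have "(c t1, c t2, c t3) = 0" if "n < d"
    using that by (simp add: c_def zero_prod_def)
  ultimately show ?thesis by blast
qed

text \<open>Taking the component of degree \<open>d\<close> reduces the coefficients to their constant terms.\<close>

lemma form_in_ideal_same_degree:
  assumes "\<forall>f\<in>entries v. form (int d) f" "form (int d) h" "h \<in> ideal_gen (entries v)"
  shows "\<exists>c. h = dot c v \<and> (\<forall>a\<in>entries c. form 0 a)"
proof -
  obtain t where "h = dot t v" using assms(3) by (auto simp: ideal_gen_entries)
  then show ?thesis
    using hcomp_dot_forms[OF assms(1), of d t] hcomp_form[OF assms(2), of d] by auto
qed

lemma form_in_ideal_degree_ge:
  assumes "\<forall>f\<in>entries v. form (int d) f" "form (int n) h" "h \<noteq> 0" "h \<in> ideal_gen (entries v)"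
  shows "d \<le> n"
proof (rule ccontr)
  assume "\<not> d \<le> n"
  moreover obtain t where "h = dot t v" using assms(4) by (auto simp: ideal_gen_entries)
  ultimately have "hcomp n h = 0"
    using hcomp_dot_forms[OF assms(1), of n t] by (auto simp: dot_linear)
  then show False using hcomp_form[OF assms(2), of n] assms(3) by simp
qed

section \<open>Saturation and codimension in the polynomial ring\<close>

lemma is_ideal_irrelevant: "is_ideal irrelevant"
  unfolding irrelevant_def by (rule is_ideal_gen)

lemma is_ideal_multipliers:
  assumes "is_ideal I"
  shows "is_ideal {b. b * h \<in> I}"
  using assms by (intro is_idealI) (auto simp: distrib_right mult.assoc intro: ideal_zero ideal_add ideal_mult)

lemma irrelevant_mult:
  assumes "is_ideal I" "\<forall>t\<in>{var_x, var_y, var_z}. t * h \<in> I" "b \<in> irrelevant"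
  shows "b * h \<in> I"
proof -
  have "irrelevant \<subseteq> {b. b * h \<in> I}"
    unfolding irrelevant_def
    by (rule ideal_gen_least[OF is_ideal_multipliers[OF assms(1)]]) (use assms(2) in blast)
  then show ?thesis using assms(3) by blast
qed

lemma ideal_pow_1_subset: "ideal_pow irrelevant (Suc 0) \<subseteq> irrelevant"
  unfolding ideal_pow.simps ideal_prod_def
  by (rule ideal_gen_least[OF is_ideal_irrelevant]) (auto intro: ideal_mult'[OF is_ideal_irrelevant])

lemma subset_saturation: "is_ideal I \<Longrightarrow> I \<subseteq> saturation I"
  unfolding saturation_def colon_def by (auto intro!: exI[of _ 0] ideal_mult')

text \<open>The closure property of \<open>J\<close> absorbs the powers of the irrelevant ideal one variable at a time.\<close>

lemma saturation_eqI:
  fixes I J :: "'k::comm_ring_1 poly3 set"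
  assumes I: "is_ideal I" and "I \<subseteq> J"
    and kill: "\<And>h t. h \<in> J \<Longrightarrow> t \<in> {var_x, var_y, var_z} \<Longrightarrow> t * h \<in> I"
    and sat: "\<And>h. \<forall>t\<in>{var_x, var_y, var_z}. t * h \<in> J \<Longrightarrow> h \<in> J"
  shows "saturation I = J"
proof
  have "h \<in> J" if "h \<in> colon I (ideal_pow irrelevant n)" for h n
    using that
  proof (induction n arbitrary: h)
    case 0
    then have "h * 1 \<in> I" unfolding colon_def ideal_pow.simps by blast
    then show ?case using \<open>I \<subseteq> J\<close> by auto
  next
    case (Suc n)
    have "t * h \<in> J" if t: "t \<in> {var_x, var_y, var_z}" for t
    proof (rule Suc.IH)
      have "t * h * b \<in> I" if b: "b \<in> ideal_pow irrelevant n" for b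
      proof -
        have "t \<in> irrelevant" using t unfolding irrelevant_def by (rule ideal_gen_base)
        then have "t * b \<in> ideal_pow irrelevant (Suc n)"
          unfolding ideal_pow.simps ideal_prod_def using b by (intro ideal_gen_base) blast
        then have "h * (t * b) \<in> I" using Suc.prems unfolding colon_def by blast
        then show ?thesis by (simp only: ac_simps)
      qed
      then show "t * h \<in> colon I (ideal_pow irrelevant n)" unfolding colon_def by blast
    qed
    then show ?case by (rule sat[OF ballI])
  qed
  then show "saturation I \<subseteq> J" unfolding saturation_def by blast
  have "h \<in> colon I (ideal_pow irrelevant (Suc 0))" if "h \<in> J" for h
    unfolding colon_def mem_Collect_eq
  proof
    fix b :: "'k poly3" assume "b \<in> ideal_pow irrelevant (Suc 0)"
    then have "b * h \<in> I"
      using ideal_pow_1_subset irrelevant_mult[OF I, of h b] kill[OF that] by blast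
    then show "h * b \<in> I" by (simp only: mult.commute)
  qed
  then show "J \<subseteq> saturation I" unfolding saturation_def by blast
qed

lemma sat_exponent_eq_1I:
  fixes I :: "'k::comm_ring_1 poly3 set"
  assumes I: "is_ideal I" and "saturation I \<noteq> I"
    and kill: "\<And>h t. h \<in> saturation I \<Longrightarrow> t \<in> {var_x, var_y, var_z} \<Longrightarrow> t * h \<in> I"
  shows "sat_exponent I = 1"
  unfolding sat_exponent_def
proof (rule antisym)
  let ?R = "{enat r |r. ideal_prod (ideal_pow irrelevant r) (saturation I) \<subseteq> I}"
  have "ideal_prod (ideal_pow irrelevant (Suc 0)) (saturation I) \<subseteq> I"
    unfolding ideal_prod_def
  proof (rule ideal_gen_least[OF I], clarify)
    fix a b :: "'k poly3" assume "a \<in> ideal_pow irrelevant (Suc 0)" "b \<in> saturation I"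
    then show "a * b \<in> I"
      using ideal_pow_1_subset irrelevant_mult[OF I, of b a] kill by blast
  qed
  then show "Inf ?R \<le> 1" by (intro Inf_lower) (auto simp: one_enat_def)
  show "1 \<le> Inf ?R"
  proof (rule Inf_greatest)
    fix e assume "e \<in> ?R"
    then obtain r where r: "e = enat r" "ideal_prod (ideal_pow irrelevant r) (saturation I) \<subseteq> I"
      by blast
    have "r \<noteq> 0"
    proof
      assume "r = 0"
      have "h \<in> I" if "h \<in> saturation I" for h
      proof -
        have "1 * h \<in> ideal_prod (ideal_pow irrelevant r) (saturation I)"
          unfolding ideal_prod_def using \<open>r = 0\<close> that by (intro ideal_gen_base) fastforce
        then show ?thesis using r(2) by auto
      qed
      then show False using subset_saturation[OF I] assms(2) by blast
    qed
    then show "1 \<le> e" by (simp add: r(1) one_enat_def)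
  qed
qed

lemma is_prime_ideal_kernel:
  assumes "\<And>f g. \<phi> (f + g) = \<phi> f + \<phi> g" "\<And>f g. \<phi> (f * g) = \<phi> f * \<phi> g"
    "\<phi> 1 = 1" "\<phi> 0 = (0 :: 'b::idom)"
  shows "is_prime_ideal {f :: 'a::comm_ring_1. \<phi> f = 0}"
  unfolding is_prime_ideal_def
proof (intro conjI allI impI)
  show "is_ideal {f. \<phi> f = 0}"
    by (rule is_idealI) (simp_all add: assms)
  have "1 \<notin> {f. \<phi> f = 0}" using assms(3) by simp
  then show "{f. \<phi> f = 0} \<noteq> UNIV" by blast
qed (use assms(2) in auto)

text \<open>The chain \<open>0 \<subset> (z) \<subset> (y, z) \<subset> (x, y, z)\<close>, each ideal being the kernel of the evaluation of some variables
at zero.\<close>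

lemma prime_height_irrelevant: "prime_height (irrelevant :: 'k::idom poly3 set) \<ge> 3"
proof -
  define c :: "nat \<Rightarrow> 'k poly3 set" where
    "c i = (if i = 0 then {f. f = 0} else if i = 1 then {f. coeff f 0 = 0}
      else if i = 2 then {f. coeff (coeff f 0) 0 = 0} else {f. coeff (coeff (coeff f 0) 0) 0 = 0})" for i
  have prime: "is_prime_ideal (c i)" for i
    using is_prime_ideal_kernel[of "\<lambda>f :: 'k poly3. f"] is_prime_ideal_kernel[of "\<lambda>f :: 'k poly3. coeff f 0"]
      is_prime_ideal_kernel[of "\<lambda>f :: 'k poly3. coeff (coeff f 0) 0"]
      is_prime_ideal_kernel[of "\<lambda>f :: 'k poly3. coeff (coeff (coeff f 0) 0) 0"]
    by (simp add: c_def coeff_mult)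
  have "[:[:[:0, 1:]:]:] \<in> c 3 - c 2" "[:[:0, 1:]:] \<in> c 2 - c 1" "[:0, 1:] \<in> c 1 - c 0"
    by (simp_all add: c_def)
  moreover have "c 0 \<subseteq> c 1" "c 1 \<subseteq> c 2" "c 2 \<subseteq> c 3" by (auto simp: c_def)
  ultimately have "c 0 \<subset> c 1" "c 1 \<subset> c 2" "c 2 \<subset> c 3" by blast+
  then have "\<forall>i<3. c i \<subset> c (Suc i)" by (auto simp: less_Suc_eq numeral_3_eq_3 numeral_2_eq_2)
  moreover have "c 3 = irrelevant" by (auto simp: c_def irrelevant_iff coeff3_def)
  ultimately have "enat 3 \<le> prime_height (irrelevant :: 'k poly3 set)"
    using prime by (intro prime_height_ge[of 3 c]) blast+
  then show ?thesis by (simp add: numeral_eq_enat)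
qed

lemma irrelevant_maximal:
  fixes P :: "'k::field poly3 set"
  assumes P: "is_prime_ideal P" and sub: "irrelevant \<subseteq> P"
  shows "P = irrelevant"
proof (rule ccontr)
  assume "P \<noteq> irrelevant"
  then obtain f where f: "f \<in> P" "f \<notin> irrelevant" using sub by blast
  define c where "c = coeff3 f 0 0 0"
  have c: "c \<noteq> 0" using f(2) by (simp add: irrelevant_iff c_def)
  have "f - [:[:[:c:]:]:] \<in> irrelevant" by (simp add: irrelevant_iff c_def coeff3_const)
  then have "[:[:[:c:]:]:] \<in> P"
    using ideal_diff[OF prime_ideal_is_ideal[OF P] f(1), of "f - [:[:[:c:]:]:]"] sub by auto
  then have "[:[:[:inverse c:]:]:] * [:[:[:c:]:]:] \<in> P"
    by (rule ideal_mult[OF prime_ideal_is_ideal[OF P]])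
  then have "1 \<in> P" using c by simp
  then have "P = UNIV" using ideal_mult[OF prime_ideal_is_ideal[OF P], of 1] by auto
  then show False using P by (simp add: is_prime_ideal_def)
qed

text \<open>A prime of height two over \<open>I\<close> misses one of the variables, since together they generate an ideal of
height at least three; it therefore contains \<open>J\<close>.\<close>

lemma codim_2_of_killed_by_irrelevant:
  fixes I J :: "'k::field poly3 set"
  assumes "codim I = 2" "I \<subseteq> J"
    and kill: "\<And>h t. h \<in> J \<Longrightarrow> t \<in> {var_x, var_y, var_z} \<Longrightarrow> t * h \<in> I"
  shows "codim J = 2"
proof (rule antisym)
  obtain P where P: "is_prime_ideal P" "I \<subseteq> P" "prime_height P = 2"
    using codim_attained[of I 2] assms(1) by (auto simp: numeral_eq_enat)
  have "\<not> irrelevant \<subseteq> P"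
  proof
    assume "irrelevant \<subseteq> P"
    then have "P = irrelevant" by (rule irrelevant_maximal[OF P(1)])
    then have "(3::enat) \<le> 2" using P(3) prime_height_irrelevant by metis
    then show False by (simp add: numeral_eq_enat)
  qed
  then have "\<not> {var_x, var_y, var_z} \<subseteq> P"
    unfolding irrelevant_def using ideal_gen_least[OF prime_ideal_is_ideal[OF P(1)], of "{var_x, var_y, var_z}"]
    by (rule contrapos_nn)
  then obtain t where t: "t \<in> {var_x, var_y, var_z}" "t \<notin> P" by blast
  have "J \<subseteq> P"
  proof
    fix h assume "h \<in> J"
    then have "t * h \<in> P" using kill t(1) P(2) by blast
    then show "h \<in> P" using t(2) P(1) unfolding is_prime_ideal_def by blast
  qed
  then show "codim J \<le> 2" using codim_le[OF P(1)] P(3) by metis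
  show "2 \<le> codim J" using codim_mono[OF assms(2)] assms(1) by simp
qed

section \<open>Triples as vectors and matrices with a carrier\<close>

fun nth3 :: "'a triple \<Rightarrow> nat \<Rightarrow> 'a" where
  "nth3 (a, b, c) i = (if i = 0 then a else if i = 1 then b else c)"

definition vec3 :: "'a triple \<Rightarrow> 'a vec" where
  "vec3 v = vec 3 (nth3 v)"

definition mat3 :: "'a triple triple \<Rightarrow> 'a mat" where
  "mat3 A = mat 3 3 (\<lambda>(i, j). nth3 (nth3 A i) j)"

lemma less_3_cases: "(i::nat) < 3 \<longleftrightarrow> i = 0 \<or> i = 1 \<or> i = 2"
  by auto

lemma vec3_carrier [simp]: "vec3 v \<in> carrier_vec 3" "dim_vec (vec3 v) = 3"
  by (simp_all add: vec3_def)

lemma mat3_carrier [simp]: "mat3 A \<in> carrier_mat 3 3" "dim_row (mat3 A) = 3" "dim_col (mat3 A) = 3"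
  by (simp_all add: mat3_def)

lemma vec3_of_list: "vec_of_list [a, b, c] = vec3 (a, b, c)"
  by (rule eq_vecI) (auto simp: vec3_def less_3_cases numeral_2_eq_2)

lemma xyz_eq: "xyz = vec3 vars"
  by (simp only: xyz_def vec3_of_list)

lemma vec3_inject: "vec3 v = vec3 w \<longleftrightarrow> v = w"
proof
  assume eq: "vec3 v = vec3 w"
  have "nth3 v i = nth3 w i" if "i < 3" for i
    using arg_cong[OF eq, of "\<lambda>x. x $ i"] that by (simp add: vec3_def)
  from this[of 0] this[of 1] this[of 2] show "v = w"
    by (cases v rule: prod_cases3; cases w rule: prod_cases3) simp
qed simp

lemma vec3_surj:
  assumes "v \<in> carrier_vec 3"
  obtains t where "v = vec3 t"
proof
  show "v = vec3 (v $ 0, v $ 1, v $ 2)"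
    using assms by (intro eq_vecI) (auto simp: vec3_def less_3_cases)
qed

lemma mat3_surj:
  assumes "\<phi> \<in> carrier_mat 3 3"
  obtains A where "\<phi> = mat3 A"
proof
  let ?r = "\<lambda>i. (\<phi> $$ (i, 0), \<phi> $$ (i, 1), \<phi> $$ (i, 2))"
  show "\<phi> = mat3 (?r 0, ?r 1, ?r 2)"
    using assms by (intro eq_matI) (auto simp: mat3_def less_3_cases)
qed

lemma vec3_0: "vec3 0 = 0\<^sub>v 3"
  by (rule eq_vecI) (auto simp: vec3_def less_3_cases zero_prod_def)

lemma smult_vec3: "r \<cdot>\<^sub>v vec3 v = vec3 (scale r v)"
  by (cases v rule: prod_cases3; rule eq_vecI) (auto simp: vec3_def less_3_cases)

lemma vec3_scalar_prod: "vec3 u \<bullet> vec3 v = dot u v"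
  by (cases u rule: prod_cases3; cases v rule: prod_cases3)
    (simp add: vec3_def scalar_prod_def numeral_3_eq_3 add.assoc)

lemma row_mat3: "i < 3 \<Longrightarrow> row (mat3 A) i = vec3 (nth3 A i)"
  by (rule eq_vecI) (auto simp: mat3_def vec3_def)

lemma mat3_mult_vec3: "mat3 A *\<^sub>v vec3 v = vec3 (mv A v)"
  by (cases A rule: prod_cases3; rule eq_vecI)
    (auto simp: row_mat3 vec3_scalar_prod less_3_cases, auto simp: vec3_def)

lemma forms_mat_mat3: "forms_mat s (mat3 A) \<longleftrightarrow> (\<forall>r\<in>entries A. \<forall>a\<in>entries r. form (int s) a)"
  by (cases A rule: triple_triple_cases) (auto simp: forms_mat_def less_3_cases mat3_def)

lemma det_carrier_mat_3:
  fixes M :: "'a::comm_ring_1 mat"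
  assumes "M \<in> carrier_mat 3 3"
  shows "det M = det3 ((M $$ (0,0), M $$ (0,1), M $$ (0,2)), (M $$ (1,0), M $$ (1,1), M $$ (1,2)),
    (M $$ (2,0), M $$ (2,1), M $$ (2,2)))"
proof -
  have det2: "det N = N $$ (0,0) * N $$ (1,1) - N $$ (0,1) * N $$ (1,0)" 
    if N: "N \<in> carrier_mat 2 2" for N :: "'a mat"
  proof -
    have det1: "det L = L $$ (0,0)" if "L \<in> carrier_mat 1 1" for L :: "'a mat"
      using that by (rule det_single) 
    have "det N = (\<Sum>j<2. N $$ (0, j) * cofactor N 0 j)"
      using laplace_expansion_row[OF N, of 0] by simp
    also have "\<dots> = N $$ (0,0) * N $$ (1,1) - N $$ (0,1) * N $$ (1,0)"
      using N by (simp add: numeral_2_eq_2 cofactor_def det1 mat_delete_def)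
    finally show ?thesis .
  qed
  have "det M = (\<Sum>j<3. M $$ (0, j) * cofactor M 0 j)"
    using laplace_expansion_row[OF assms, of 0] by simp
  also have "\<dots> = M $$ (0,0) * cofactor M 0 0 + M $$ (0,1) * cofactor M 0 1 + M $$ (0,2) * cofactor M 0 2"
    by (simp add: numeral_3_eq_3 numeral_2_eq_2)
  finally show ?thesis
    using assms by (simp add: cofactor_def det2 mat_delete_def algebra_simps numeral_2_eq_2)
qed

lemma det_mat3: "det (mat3 A) = det3 A"
  by (cases A rule: triple_triple_cases) (simp add: det_carrier_mat_3, simp add: mat3_def)

text \<open>A set of \<open>n\<close> among \<open>n + 1\<close> column indices is described by the index that it omits; this turns the
minors, indexed by sets, into a list.\<close>

lemma pick_omit:
  assumes "m \<le> n" "i < n"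
  shows "pick ({..n} - {m}) i = (if i < m then i else Suc i)"
proof -
  let ?Q = "{..n} - {m}" and ?k = "if i < m then i else Suc i"
  have "?k \<in> ?Q" using assms by auto
  then have "pick ?Q (card {a \<in> ?Q. a < ?k}) = ?k" by (rule pick_card_in_set)
  moreover have "{a \<in> ?Q. a < ?k} = (if i < m then {..<i} else {..i} - {m})"
    using assms by auto
  then have "card {a \<in> ?Q. a < ?k} = i" using assms by auto
  ultimately show ?thesis by (simp only:)
qed

lemma pick_lessThan: "i < n \<Longrightarrow> pick {..<n} i = i"
  using pick_omit[of n n i] by (simp add: lessThan_Suc_atMost[symmetric] lessThan_Suc insert_Diff_if)

lemma submatrix_omit_col:
  assumes M: "M \<in> carrier_mat n (Suc n)" and m: "m \<le> n"
  shows "submatrix M {..<n} ({..n} - {m}) = mat n n (\<lambda>(i, j). M $$ (i, if j < m then j else Suc j))"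
proof -
  have rows: "{i. i < dim_row M \<and> i \<in> {..<n}} = {..<n}" using M by auto
  have cols: "{j. j < dim_col M \<and> j \<in> {..n} - {m}} = {..n} - {m}" using M by auto
  have card: "card {i. i < dim_row M \<and> i \<in> {..<n}} = n"
    "card {j. j < dim_col M \<and> j \<in> {..n} - {m}} = n"
    unfolding rows cols using m by simp_all
  show ?thesis
  proof (rule eq_matI)
    fix i j assume "i < dim_row (mat n n (\<lambda>(i, j). M $$ (i, if j < m then j else Suc j)))"
      "j < dim_col (mat n n (\<lambda>(i, j). M $$ (i, if j < m then j else Suc j)))"
    then have ij: "i < n" "j < n" by auto
    then have "submatrix M {..<n} ({..n} - {m}) $$ (i, j) = M $$ (pick {..<n} i, pick ({..n} - {m}) j)"
      by (intro submatrix_index) (simp_all only: card)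
    then show "submatrix M {..<n} ({..n} - {m}) $$ (i, j)
        = mat n n (\<lambda>(i, j). M $$ (i, if j < m then j else Suc j)) $$ (i, j)"
      using ij m by (simp add: pick_omit pick_lessThan)
  qed (simp_all only: dim_submatrix card dim_row_mat dim_col_mat)
qed

lemma subset_atMost_card_eq_omit:
  assumes "Q \<subseteq> {..n}" "card Q = n"
  shows "\<exists>m\<le>n. Q = {..n} - {m}"
proof -
  have "card ({..n} - Q) = 1"
    using assms by (subst card_Diff_subset) (auto intro: finite_subset)
  then obtain m where "{..n} - Q = {m}" by (rule card_1_singletonE)
  then have "m \<le> n" "Q = {..n} - {m}" using assms(1) by auto
  then show ?thesis by blast
qed

lemma prepend_col_carrier: "prepend_col (vec3 X) (mat3 A) \<in> carrier_mat 3 (Suc 3)"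
  by (rule carrier_matI) (simp_all add: prepend_col_def)

lemma prepend_col_index:
  assumes "i < 3" "j < 4"
  shows "prepend_col (vec3 X) (mat3 A) $$ (i, j) = (case j of 0 \<Rightarrow> nth3 X i | Suc j' \<Rightarrow> nth3 (nth3 A i) j')"
  using assms unfolding prepend_col_def
  by (subst mat_of_cols_index) (auto simp: vec3_def mat3_def split: nat.split)

text \<open>The minor of \<open>[X | A]\<close> that omits column \<open>m\<close>, where column \<open>0\<close> is \<open>X\<close>.\<close>

definition minor :: "'a::comm_ring_1 triple triple \<Rightarrow> 'a triple \<Rightarrow> nat \<Rightarrow> 'a" where
  "minor A X m = det (submatrix (prepend_col (vec3 X) (mat3 A)) {..<3} ({..3} - {m}))"

lemma minor_eq_det3:
  fixes A :: "'a::comm_ring_1 triple triple"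
  assumes "m \<le> 3"
  shows "minor A X m =
    (let e = \<lambda>i j. case (if j < m then j else Suc j) of 0 \<Rightarrow> nth3 X i | Suc j' \<Rightarrow> nth3 (nth3 A i) j'
     in det3 ((e 0 0, e 0 1, e 0 2), (e 1 0, e 1 1, e 1 2), (e 2 0, e 2 1, e 2 2)))"
proof -
  let ?M = "mat 3 3 (\<lambda>(i, j). prepend_col (vec3 X) (mat3 A) $$ (i, if j < m then j else Suc j))"
  have "minor A X m = det ?M"
    unfolding minor_def submatrix_omit_col[OF prepend_col_carrier assms] ..
  also have "?M \<in> carrier_mat 3 3" by simp
  note det_carrier_mat_3[OF this]
  finally show ?thesis unfolding Let_def
    by (simp add: prepend_col_index del: det3.simps)
qed

lemma minor_values:
  "minor A (x, y, z) 0 = det3 A"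
  "cramer A (x, y, z) = (minor A (x, y, z) 1, - minor A (x, y, z) 2, minor A (x, y, z) 3)"
proof -
  obtain a1 a2 a3 b1 b2 b3 c1 c2 c3 where A: "A = ((a1, a2, a3), (b1, b2, b3), (c1, c2, c3))"
    by (rule triple_triple_cases)
  show "minor A (x, y, z) 0 = det3 A"
    by (subst minor_eq_det3) (simp_all add: A numeral_2_eq_2)
  have "minor A (x, y, z) 1 = det3 ((x, a2, a3), (y, b2, b3), (z, c2, c3))"
    "minor A (x, y, z) 2 = det3 ((x, a1, a3), (y, b1, b3), (z, c1, c3))"
    "minor A (x, y, z) 3 = det3 ((x, a1, a2), (y, b1, b2), (z, c1, c2))"
    by (subst minor_eq_det3; simp add: A numeral_2_eq_2 del: det3.simps)+
  then show "cramer A (x, y, z) = (minor A (x, y, z) 1, - minor A (x, y, z) 2, minor A (x, y, z) 3)"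
    by (simp only:) (simp add: A cramer_def algebra_simps)
qed

lemma ideal_gen_uminus:
  "ideal_gen ({- b} \<union> S) = ideal_gen ({b} \<union> S)"
proof (rule ideal_gen_eqI)
  have "- b \<in> ideal_gen ({b} \<union> S)" "b \<in> ideal_gen ({- b} \<union> S)"
    using ideal_uminus[OF is_ideal_gen ideal_gen_base, of b "{b} \<union> S"]
      ideal_uminus[OF is_ideal_gen ideal_gen_base, of "- b" "{- b} \<union> S"] by simp_all
  then show "{- b} \<union> S \<subseteq> ideal_gen ({b} \<union> S)" "{b} \<union> S \<subseteq> ideal_gen ({- b} \<union> S)"
    by (auto intro: ideal_gen_base)
qed

lemma card_3_subsets: "Q \<subseteq> {..3} \<and> card Q = 3 \<longleftrightarrow>
    Q = {..3} - {0} \<or> Q = {..3} - {1} \<or> Q = {..3} - {2} \<or> Q = {..3} - {3::nat}"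
  (is "?L \<longleftrightarrow> ?R")
proof
  assume ?L
  then obtain m where "m \<le> 3" "Q = {..3} - {m}" using subset_atMost_card_eq_omit by blast
  moreover from \<open>m \<le> 3\<close> have "m = 0 \<or> m = 1 \<or> m = 2 \<or> m = 3" by auto
  ultimately show ?R by blast
next
  assume ?R
  then show ?L by (elim disjE) (simp_all add: card_Diff_subset)
qed

lemma cramer_ideal_mat3: "cramer_ideal (vec3 X) (mat3 A) = ideal_gen (entries (cramer A X))"
proof -
  obtain x y z where X: "X = (x, y, z)" by (cases X)
  have Q: "Q \<subseteq> {..3} \<and> card Q = 3 \<and> 0 \<in> Q \<longleftrightarrow>
      Q = {..3} - {1} \<or> Q = {..3} - {2} \<or> Q = {..3} - {3}" for Q :: "nat set"
  proof -
    have "0 \<notin> {..3} - {0::nat}" "0 \<in> {..3} - {1::nat}" "0 \<in> {..3} - {2::nat}" "0 \<in> {..3} - {3::nat}"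
      by simp_all
    then show ?thesis using card_3_subsets[of Q] by metis
  qed
  have image: "{f Q |Q. Q = a \<or> Q = b \<or> Q = c} = {f a, f b, f c}" for f :: "nat set \<Rightarrow> 'a" and a b c
    by blast
  have "{det (submatrix (prepend_col (vec3 X) (mat3 A)) {..<3} Q) |Q. Q \<subseteq> {..3} \<and> card Q = 3 \<and> 0 \<in> Q}
      = {minor A X 1, minor A X 2, minor A X 3}"
    unfolding Q minor_def by (rule image)
  moreover have "ideal_gen {minor A X 1, minor A X 2, minor A X 3} = ideal_gen (entries (cramer A X))"
    using ideal_gen_uminus[of "minor A X 2" "{minor A X 1, minor A X 3}"]
    unfolding X minor_values(2) entries.simps insert_is_Un[symmetric] by (simp only: insert_commute)
  ultimately show ?thesis unfolding cramer_ideal_def vec3_carrier by (simp only:)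
qed

lemma det_ideal_mat3:
  "det_ideal 3 (prepend_col (vec3 X) (mat3 A)) = ideal_gen (insert (det3 A) (entries (cramer A X)))"
proof -
  obtain x y z where X: "X = (x, y, z)" by (cases X)
  have PQ: "P \<subseteq> {..<3} \<and> Q \<subseteq> {..<Suc 3} \<and> card P = 3 \<and> card Q = 3 \<longleftrightarrow> P = {..<3} \<and>
      (Q = {..3} - {0} \<or> Q = {..3} - {1} \<or> Q = {..3} - {2} \<or> Q = {..3} - {3})" for P Q :: "nat set"
  proof -
    have "P \<subseteq> {..<3} \<and> card P = 3 \<longleftrightarrow> P = {..<3}"
      using card_subset_eq[of "{..<3}" P] by auto
    then show ?thesis using card_3_subsets[of Q] unfolding lessThan_Suc_atMost by argo
  qed
  have image: "{f P Q |P Q. P = p \<and> (Q = a \<or> Q = b \<or> Q = c \<or> Q = d)} = {f p a, f p b, f p c, f p d}"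
    for f :: "nat set \<Rightarrow> nat set \<Rightarrow> 'a" and p a b c d
    by blast
  have "{det (submatrix (prepend_col (vec3 X) (mat3 A)) P Q) | P Q.
      P \<subseteq> {..<3} \<and> Q \<subseteq> {..<Suc 3} \<and> card P = 3 \<and> card Q = 3}
    = {minor A X 0, minor A X 1, minor A X 2, minor A X 3}"
    unfolding PQ minor_def by (rule image)
  moreover have "ideal_gen {minor A X 0, minor A X 1, minor A X 2, minor A X 3} =
      ideal_gen (insert (det3 A) (entries (cramer A X)))"
    using ideal_gen_uminus[of "minor A X 2" "{minor A X 0, minor A X 1, minor A X 3}"]
    unfolding X minor_values entries.simps insert_is_Un[symmetric]
    by (simp only: insert_commute)
  moreover have "dim_row (prepend_col (vec3 X) (mat3 A)) = 3" "dim_col (prepend_col (vec3 X) (mat3 A)) = Suc 3"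
    by (rule carrier_matD[OF prepend_col_carrier])+
  ultimately show ?thesis unfolding det_ideal_def by (simp only:)
qed

section \<open>The pivot is a maximal minor\<close>

abbreviation forms :: "int \<Rightarrow> 'k::comm_ring_1 poly3 triple \<Rightarrow> bool" where
  "forms e v \<equiv> \<forall>a\<in>entries v. form e a"

abbreviation row_forms :: "int \<Rightarrow> 'k::comm_ring_1 poly3 triple triple \<Rightarrow> bool" where
  "row_forms e A \<equiv> \<forall>r\<in>entries A. forms e r"

lemma forms_vars: "forms 1 vars"
  using form_vars by simp

lemma forms_add: "forms e u \<Longrightarrow> forms e v \<Longrightarrow> forms e (u + v)"
  by (cases u rule: prod_cases3; cases v rule: prod_cases3) (simp add: form_add)

lemma forms_scale: "form d r \<Longrightarrow> forms e v \<Longrightarrow> forms (d + e) (scale r v)"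
  by (cases v rule: prod_cases3) (simp add: form_mult)

lemma form_dot: "forms d u \<Longrightarrow> forms e v \<Longrightarrow> form (d + e) (dot u v)"
  by (cases u rule: prod_cases3; cases v rule: prod_cases3) (simp add: form_add form_mult)

lemma forms_cross: "forms d u \<Longrightarrow> forms e v \<Longrightarrow> forms (d + e) (cross u v)"
  by (cases u rule: prod_cases3; cases v rule: prod_cases3) (simp add: form_diff form_mult)

lemma forms_tmv: "row_forms d A \<Longrightarrow> forms e v \<Longrightarrow> forms (d + e) (tmv A v)"
proof -
  assume A: "row_forms d A" and v: "forms e v"
  obtain r1 r2 r3 a b c where c: "A = (r1, r2, r3)" "v = (a, b, c)" by (metis prod_cases3)
  have "forms (e + d) (tmv A v)"
    unfolding c tmv.simps by (intro forms_add forms_scale) (use A v c in simp_all)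
  then show ?thesis by (simp only: add.commute)
qed

lemma row_forms_cofactors: "row_forms s A \<Longrightarrow> row_forms (s + s) (cofactors A)"
proof -
  assume A: "row_forms s A"
  obtain r1 r2 r3 where c: "A = (r1, r2, r3)" by (cases A)
  have r: "forms s r1" "forms s r2" "forms s r3" using A unfolding c by simp_all
  show ?thesis
    using forms_cross[OF r(2,3)] forms_cross[OF r(3,1)] forms_cross[OF r(1,2)]
    unfolding c cofactors.simps by simp
qed

lemma forms_cramer:
  assumes "row_forms (int s) A"
  shows "forms (int (2 * s + 1)) (cramer A vars)"
proof -
  have deg: "int (2 * s + 1) = int s + int s + 1" by simp
  show ?thesis
    unfolding cramer_def deg by (rule forms_tmv[OF row_forms_cofactors[OF assms] forms_vars])
qed

lemma form_det3: "row_forms (int s) A \<Longrightarrow> form (int (3 * s)) (det3 A)"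
proof -
  assume A: "row_forms (int s) A"
  obtain r1 r2 r3 where c: "A = (r1, r2, r3)" by (cases A)
  have r: "forms (int s) r1" "forms (int s) r2" "forms (int s) r3" using A unfolding c by simp_all
  show ?thesis unfolding c det3.simps using form_dot[OF r(1) forms_cross[OF r(2,3)]] by simp
qed

lemma no_common_prime_of_generators:
  fixes S :: "'a::ufd set"
  assumes "codim (ideal_gen S) \<ge> 2"
  shows "\<not> (\<exists>p. prime_elem p \<and> (\<forall>b\<in>S. p dvd b))"
proof
  assume "\<exists>p. prime_elem p \<and> (\<forall>b\<in>S. p dvd b)"
  then obtain p where p: "prime_elem p" "S \<subseteq> {a. p dvd a}" by (auto simp: subset_iff)
  then have "ideal_gen S \<subseteq> {a. p dvd a}" by (intro ideal_gen_least is_ideal_multiples)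
  then show False using no_common_prime_of_codim[OF assms] p(1) by (auto simp: subset_iff)
qed

lemma no_common_prime_of_minors:
  fixes v :: "'a::ufd triple"
  assumes "codim (ideal_gen (entries v)) = 2"
  shows "\<not> (\<exists>p. prime_elem p \<and> (\<forall>b\<in>insert g (entries v). p dvd b))"
proof -
  have "\<not> (\<exists>p. prime_elem p \<and> (\<forall>b\<in>entries v. p dvd b))"
    by (rule no_common_prime_of_generators) (simp only: assms order_refl)
  then show ?thesis unfolding ball_simps by iprover
qed

lemma ideal_gen_entries_scale_unit:
  assumes "u * w = 1"
  shows "ideal_gen (entries (scale w v)) = ideal_gen (entries v)"
proof -
  have sub: "ideal_gen (entries (scale r v)) \<subseteq> ideal_gen (entries v)" for r and v :: "'a triple"
  proof
    fix h assume "h \<in> ideal_gen (entries (scale r v))"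
    then obtain t where "h = dot t (scale r v)" by (auto simp: ideal_gen_entries)
    then have "h = dot (scale r t) v" by (simp add: dot_linear)
    then show "h \<in> ideal_gen (entries v)" unfolding ideal_gen_entries by (rule exI)
  qed
  have "v = scale u (scale w v)" using assms by (simp add: scale_simps)
  then show ?thesis using sub[of w v] sub[of u "scale w v"] by auto
qed

lemma unit_eq_const:
  fixes q :: "'k::field poly3"
  assumes "q dvd 1"
  obtains c where "q = [:[:[:c:]:]:]" "c \<noteq> 0"
  using assms by (auto simp: is_unit_poly_iff elim!: degree_eq_zeroE)

lemma cramer_scale_right: "cramer A (scale r X) = scale r (cramer A X)"
  by (simp only: cramer_def tmv_linear)

lemma det3_scale: "det3 (scale t r1, scale t r2, scale t r3) = t ^ 3 * det3 (r1, r2, r3)"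
  by (simp add: cross_linear dot_linear power3_eq_cube mult.assoc)

lemma cramer_scale:
  "cramer (scale t r1, scale t r2, scale t r3) X = scale (t ^ 2) (cramer (r1, r2, r3) X)"
  by (cases X rule: prod_cases3) (simp add: cramer_def cross_linear scale_simps power2_eq_square mult_ac)

text \<open>Multiplying \<open>A f = g X\<close> by the adjugate gives \<open>(det A) f = g D\<close>. As the minors have no common prime
factor, \<open>det A\<close> divides \<open>g\<close>; the quotient divides all entries of \<open>f\<close> and is therefore constant.\<close>

lemma pivot_is_maximal_minor:
  fixes f :: "'k::alg_closed_field poly3 triple"
  assumes I: "codim (ideal_gen (entries f)) = 2"
    and f0: "f \<noteq> 0"
    and A: "row_forms (int s) A" "mv A f = scale g vars" and g: "g \<noteq> 0"
    and M: "codim (ideal_gen (insert (det3 A) (entries (cramer A vars)))) = 2"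
  shows "\<exists>B u. row_forms (int s) B \<and> g = det3 B \<and> form 0 u \<and> u \<noteq> 0 \<and> f = scale u (cramer B vars)"
proof -
  define D where "D = cramer A vars"
  have coprime: "\<not> (\<exists>p. prime_elem p \<and> (\<forall>b\<in>insert (det3 A) (entries D). p dvd b))"
    using M unfolding D_def by (intro no_common_prime_of_generators) simp
  have fD: "scale (det3 A) f = scale g D"
    using cramer_mv[of A f] unfolding A(2) cramer_scale_right D_def by (rule sym)
  have det: "det3 A \<noteq> 0"
  proof
    \<comment> \<open>Otherwise all minors vanish, and any prime element divides them.\<close>
    assume 0: "det3 A = 0"
    then have "scale g D = scale g 0" using fD by (simp add: scale_simps)
    then have "D = 0" using g by (simp only: scale_cancel) simp
    have "\<not> var_x dvd (1 :: 'k poly3)" by (auto simp: is_unit_poly_iff)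
    then have "\<exists>p :: 'k poly3. prime_elem p" using ex_prime_elem_dvd[of "var_x :: 'k poly3"] by auto
    then obtain p :: "'k poly3" where p: "prime_elem p" by (rule exE)
    moreover have "\<forall>b\<in>insert (det3 A) (entries D). p dvd b"
      unfolding 0 \<open>D = 0\<close> by (simp add: zero_prod_def)
    ultimately have "\<exists>p. prime_elem p \<and> (\<forall>b\<in>insert (det3 A) (entries D). p dvd b)"
      by (intro exI conjI)
    with coprime show False ..
  qed
  have "det3 A dvd g * b" if "b \<in> entries D" for b
  proof -
    have "\<forall>a\<in>entries (scale g D). det3 A dvd a" unfolding fD[symmetric] entries_scale by simp
    then show ?thesis using that by (auto simp: entries_scale)
  qed
  then have "det3 A dvd g" by (intro dvd_of_dvd_mult_all[OF coprime det]) auto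
  then obtain q where q: "g = det3 A * q" by (rule dvdE)
  then have "scale (det3 A) f = scale (det3 A) (scale q D)" using fD by (simp add: scale_simps)
  then have f: "f = scale q D" using det by (simp add: scale_cancel)
  have "q \<noteq> 0" using g q by auto
  have "q dvd 1"
  proof (rule ccontr)
    assume "\<not> q dvd 1"
    then obtain p where p: "prime_elem p" "p dvd q" using ex_prime_elem_dvd[of q] \<open>q \<noteq> 0\<close> by auto
    then have "\<forall>b\<in>entries f. p dvd b" unfolding f by (auto simp: entries_scale)
    then show False using no_common_prime_of_generators[of "entries f"] I p(1) by auto
  qed
  then obtain c where c: "q = [:[:[:c:]:]:]" "c \<noteq> 0" by (rule unit_eq_const)
  \<comment> \<open>The determinant is cubic and the minors \<open>D\<close> are quadratic in the matrix, so scaling it by a cube root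
    of \<open>q\<close> multiplies \<open>det A\<close> by \<open>q\<close> and \<open>D\<close> by a constant.\<close>
  obtain t where t: "t ^ 3 = c" using nth_root_exists[of 3 c] by auto
  define T where "T = [:[:[:t:]:]:]"
  have T: "T ^ 3 = q" "form 0 T" "T \<noteq> 0"
    using t c by (auto simp: T_def form_const power3_eq_cube)
  obtain r1 r2 r3 where r: "A = (r1, r2, r3)" by (cases A)
  define B where "B = (scale T r1, scale T r2, scale T r3)"
  have "row_forms (int s) B"
  proof -
    have "forms (int s) r1" "forms (int s) r2" "forms (int s) r3" using A(1) unfolding r by simp_all
    from this[THEN forms_scale[OF T(2)]] show ?thesis unfolding B_def by simp
  qed
  moreover have "g = det3 B" unfolding B_def det3_scale T(1) q r by (rule mult.commute)
  moreover have "f = scale T (cramer B vars)"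
  proof -
    have "q = T * T ^ 2" using T(1) by (simp add: power3_eq_cube power2_eq_square mult.assoc)
    then show ?thesis unfolding B_def cramer_scale scale_simps f D_def r by (simp only:)
  qed
  ultimately show ?thesis using T(2,3) by (intro exI conjI)
qed

section \<open>The free resolution\<close>

fun transp :: "'a triple triple \<Rightarrow> 'a triple triple" where
  "transp ((a1, a2, a3), (b1, b2, b3), (c1, c2, c3)) = ((a1, b1, c1), (a2, b2, c2), (a3, b3, c3))"

text \<open>The matrix of the map \<open>v \<mapsto> u \<times> v\<close>, the middle map of the Koszul complex when \<open>u\<close> is the column of
the variables.\<close>

fun cross_mat :: "'a::comm_ring_1 triple \<Rightarrow> 'a triple triple" where
  "cross_mat (x, y, z) = ((0, - z, y), (z, 0, - x), (- y, x, 0))"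

lemma mv_transp: "mv (transp A) v = tmv A v"
  by (cases A rule: triple_triple_cases; cases v rule: prod_cases3) (simp add: mult.commute)

lemma mv_cross_mat: "mv (cross_mat u) v = cross u v"
  by (cases u rule: prod_cases3; cases v rule: prod_cases3) (simp add: algebra_simps)

lemma row_forms_transp: "row_forms e A \<Longrightarrow> row_forms e (transp A)"
  by (cases A rule: triple_triple_cases) simp

lemma row_forms_cross_mat: "forms e v \<Longrightarrow> row_forms e (cross_mat v)"
  by (cases v rule: prod_cases3) (simp add: form_uminus)

lemma row_forms_mm: "row_forms d A \<Longrightarrow> row_forms e B \<Longrightarrow> row_forms (e + d) (mm A B)"
proof -
  assume A: "row_forms d A" and B: "row_forms e B"
  obtain r1 r2 r3 where c: "A = (r1, r2, r3)" by (cases A)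
  have "forms d r1" "forms d r2" "forms d r3" using A unfolding c by simp_all
  from this[THEN forms_tmv[OF B]] show ?thesis unfolding c mm.simps by simp
qed

lemma nth3_in_entries: "nth3 v i \<in> entries v"
  by (cases v rule: prod_cases3) simp

definition row_mat :: "'a triple \<Rightarrow> 'a mat" where
  "row_mat v = mat 1 3 (\<lambda>(i, j). nth3 v j)"

definition col_mat :: "'a triple \<Rightarrow> 'a mat" where
  "col_mat v = mat 3 1 (\<lambda>(i, j). nth3 v i)"

definition vec1 :: "'a \<Rightarrow> 'a vec" where
  "vec1 r = vec 1 (\<lambda>_. r)"

lemma row_mat_mult: "row_mat f *\<^sub>v vec3 v = vec1 (dot f v)"
proof -
  have "row (row_mat f) 0 = vec3 f"
    by (rule eq_vecI) (simp_all add: row_mat_def vec3_def)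
  then show ?thesis
    by (intro eq_vecI) (simp_all add: vec1_def row_mat_def[of f] vec3_scalar_prod mult_mat_vec_def)
qed

lemma col_mat_mult: "w \<in> carrier_vec 1 \<Longrightarrow> col_mat v *\<^sub>v w = vec3 (scale (w $ 0) v)"
  by (cases v rule: prod_cases3; rule eq_vecI)
    (auto simp: col_mat_def vec3_def scalar_prod_def less_3_cases mult.commute)

lemma carrier_vec_3: "carrier_vec 3 = range vec3"
  by (auto elim: vec3_surj)

lemma vec1_index: "vec1 r $ 0 = r"
  by (simp add: vec1_def)

lemma carrier_vec_1: "carrier_vec 1 = range vec1"
proof
  show "carrier_vec 1 \<subseteq> range (vec1 :: 'a \<Rightarrow> 'a vec)"
  proof
    fix v :: "'a vec" assume "v \<in> carrier_vec 1"
    then have "v = vec1 (v $ 0)" by (intro eq_vecI) (auto simp: vec1_def)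
    then show "v \<in> range vec1" by (rule range_eqI)
  qed
qed (auto simp: vec1_def)

lemma vec1_inject: "vec1 r = vec1 r' \<longleftrightarrow> r = r'"
  by (metis vec1_index)

lemma zero_vec_1: "0\<^sub>v 1 = vec1 0"
  by (rule eq_vecI) (simp_all add: vec1_def)

lemma image_row_mat: "(\<lambda>v. row_mat f *\<^sub>v v) ` carrier_vec 3 = {v \<in> carrier_vec 1. v $ 0 \<in> ideal_gen (entries f)}"
proof
  show "(\<lambda>v. row_mat f *\<^sub>v v) ` carrier_vec 3 \<subseteq> {v \<in> carrier_vec 1. v $ 0 \<in> ideal_gen (entries f)}"
    unfolding carrier_vec_3 image_image row_mat_mult ideal_gen_entries carrier_vec_1
    using dot_commute by (fastforce simp: vec1_index)
  show "{v \<in> carrier_vec 1. v $ 0 \<in> ideal_gen (entries f)} \<subseteq> (\<lambda>v. row_mat f *\<^sub>v v) ` carrier_vec 3"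
  proof
    fix w assume "w \<in> {v \<in> carrier_vec 1. v $ 0 \<in> ideal_gen (entries f)}"
    then obtain r t where "w = vec1 r" "r = dot t f"
      unfolding carrier_vec_1 ideal_gen_entries by (auto simp: vec1_index)
    then have "w = row_mat f *\<^sub>v vec3 t" by (simp only: row_mat_mult dot_commute)
    then show "w \<in> (\<lambda>v. row_mat f *\<^sub>v v) ` carrier_vec 3" by (rule image_eqI) simp
  qed
qed

lemma kernel_row_mat: "mat_kernel (row_mat f) = vec3 ` {v. dot f v = 0}"
proof -
  have "mat_kernel (row_mat f) = {v \<in> carrier_vec 3. row_mat f *\<^sub>v v = 0\<^sub>v 1}"
    by (simp add: mat_kernel_def row_mat_def)
  also have "\<dots> = {v \<in> range vec3. row_mat f *\<^sub>v v = vec1 0}"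
    unfolding carrier_vec_3 zero_vec_1 ..
  also have "\<dots> = vec3 ` {v. dot f v = 0}"
    by (auto simp: row_mat_mult vec1_inject simp del: split_paired_All split_paired_Ex)
  finally show ?thesis .
qed

lemma image_mat3: "(\<lambda>v. mat3 A *\<^sub>v v) ` carrier_vec 3 = vec3 ` range (mv A)"
  unfolding carrier_vec_3 image_image mat3_mult_vec3 ..

lemma kernel_mat3: "mat_kernel (mat3 A) = vec3 ` {v. mv A v = 0}"
  by (auto simp: mat_kernel_def carrier_vec_3 mat3_mult_vec3 vec3_0[symmetric] vec3_inject)

lemma col_mat_mult_vec1: "col_mat v *\<^sub>v vec1 r = vec3 (scale r v)"
  using col_mat_mult[of "vec1 r" v] unfolding carrier_vec_1 vec1_index by blast

lemma image_col_mat: "(\<lambda>w. col_mat v *\<^sub>v w) ` carrier_vec 1 = vec3 ` range (\<lambda>r. scale r v)"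
  unfolding carrier_vec_1 image_image col_mat_mult_vec1 ..

lemma kernel_col_mat:
  fixes v :: "'a::idom triple"
  assumes "v \<noteq> 0"
  shows "mat_kernel (col_mat v) = {0\<^sub>v 1}"
proof -
  have "mat_kernel (col_mat v) = {w \<in> carrier_vec 1. col_mat v *\<^sub>v w = vec3 0}"
    by (simp add: mat_kernel_def col_mat_def vec3_0)
  also have "\<dots> = {w \<in> range vec1. col_mat v *\<^sub>v w = vec3 0}"
    unfolding carrier_vec_1 ..
  also have "\<dots> = {vec1 0}"
  proof -
    have "scale r v = 0 \<longleftrightarrow> r = 0" for r
      using scale_cancel[of r v 0] assms by (auto simp: scale_simps)
    then show ?thesis by (auto simp: col_mat_mult_vec1 vec3_inject)
  qed
  finally show ?thesis unfolding zero_vec_1 .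
qed

lemma all_less_3: "P 0 \<Longrightarrow> P (Suc 0) \<Longrightarrow> P (Suc (Suc 0)) \<Longrightarrow> \<forall>i<Suc (Suc (Suc 0)). P i"
  by (auto simp: less_Suc_eq)

text \<open>The differentials are the row \<open>f\<close>, the Koszul map followed by the transpose of \<open>B\<close>, and the column
of the variables. A relation between the entries of \<open>f\<close> is a relation between the minors in which
\<open>det B\<close> does not occur, so its coefficient vector \<open>a\<close> satisfies \<open>a \<bullet> X = 0\<close> and comes from the Koszul complex.\<close>

lemma resolution_of_cramer_ideal:
  fixes B :: "'k::field poly3 triple triple"
  assumes B: "row_forms (int s) B" and g: "det3 B \<noteq> 0"
    and coprime: "\<not> (\<exists>p. prime_elem p \<and> (\<forall>b\<in>insert (det3 B) (entries (cramer B vars)). p dvd b))"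
    and u: "form 0 u" "u \<noteq> 0" and f: "f = scale u (cramer B vars)"
  shows "\<exists>D. min_graded_free_resolution (ideal_gen (entries f))
    [[0], replicate 3 (int (2 * s + 1)), replicate 3 (int (3 * s + 2)), [int (3 * s + 3)]] D"
proof -
  define A where "A = mm (transp B) (cross_mat vars)"
  have mvA: "mv A v = tmv B (cross vars v)" for v
    unfolding A_def mv_mm mv_cross_mat mv_transp ..
  have degA: "row_forms (int (s + 1)) A"
    using row_forms_mm[OF row_forms_transp[OF B] row_forms_cross_mat[OF forms_vars]] by (simp add: A_def add.commute)
  have degf: "forms (int (2 * s + 1)) f"
    using forms_scale[OF u(1) forms_cramer[OF B]] by (simp add: f)
  have ker_f: "(\<exists>w. v = mv A w) \<longleftrightarrow> dot f v = 0" for v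
  proof
    have "dot f (mv A w) = u * (det3 B * dot vars (cross vars w))" for w
      unfolding mvA f dot_linear dot_commute[of _ "tmv _ _"] dot_tmv mv_cramer
      by (simp only: dot_commute)
    then show "dot f v = 0" if "\<exists>w. v = mv A w"
      using that unfolding dot_cross by auto
  next
    assume "dot f v = 0"
    then have "dot (cramer B vars) v = 0" using u(2) unfolding f dot_linear by simp
    then have "0 * det3 B + dot v (cramer B vars) = 0"
      unfolding dot_commute[of v] by simp
    from syzygy_of_minors[OF g coprime this] obtain a where a: "v = tmv B a" "0 = - dot a vars"
      by (elim exE conjE)
    then have "dot vars a = 0" unfolding dot_commute[of vars] by simp
    from koszul_exact_middle[OF this] obtain w where w: "a = cross vars w" ..
    show "\<exists>w. v = mv A w" unfolding mvA a(1) w by (rule exI) (rule refl)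
  qed
  have ker_A: "(\<exists>r. v = scale r vars) \<longleftrightarrow> mv A v = 0" for v
  proof
    assume "\<exists>r. v = scale r vars"
    then obtain r where v: "v = scale r vars" ..
    show "mv A v = 0" unfolding mvA v cross_linear cross_self scale_simps tmv_linear ..
  next
    assume "mv A v = 0"
    then have "tmv B (cross vars v) = tmv B 0" unfolding mvA tmv_linear .
    then have "cross vars v = 0" by (rule tmv_inj[OF g])
    then show "\<exists>r. v = scale r vars" by (rule koszul_exact_left)
  qed
  define C where "C = col_mat (vars :: 'k poly3 triple)"
  let ?sh = "[[0], replicate 3 (int (2 * s + 1)), replicate 3 (int (3 * s + 2)), [int (3 * s + 3)]]"
  let ?D = "[row_mat f, mat3 A, C]"
  have carrier: "row_mat f \<in> carrier_mat 1 3" "mat3 A \<in> carrier_mat 3 3" "C \<in> carrier_mat 3 1"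
    by (simp_all add: row_mat_def C_def col_mat_def)
  have entries: "form (int (2 * s + 1)) (row_mat f $$ (0, j))"
    "form (int (s + 1)) (mat3 A $$ (i, j))" "form 1 (C $$ (i, 0))" if "i < 3" "j < 3" for i j
  proof -
    have eqs: "row_mat f $$ (0, j) = nth3 f j" "mat3 A $$ (i, j) = nth3 (nth3 A i) j"
      "C $$ (i, 0) = nth3 vars i"
      unfolding row_mat_def mat3_def C_def col_mat_def using that by (subst index_mat; simp)+
    show "form (int (2 * s + 1)) (row_mat f $$ (0, j))"
      unfolding eqs by (rule bspec[OF degf nth3_in_entries])
    show "form (int (s + 1)) (mat3 A $$ (i, j))"
      unfolding eqs by (rule bspec[OF bspec[OF degA nth3_in_entries] nth3_in_entries])
    show "form 1 (C $$ (i, 0))"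
      unfolding eqs by (rule bspec[OF forms_vars nth3_in_entries])
  qed
  have sh: "?sh ! 0 = [0]" "?sh ! 1 = replicate 3 (int (2 * s + 1))"
    "?sh ! 2 = replicate 3 (int (3 * s + 2))" "?sh ! 3 = [int (3 * s + 3)]"
    by simp_all
  have D: "?D ! 0 = row_mat f" "?D ! 1 = mat3 A" "?D ! 2 = C" by simp_all
  have "min_graded_free_resolution (ideal_gen (entries f)) ?sh ?D"
    unfolding min_graded_free_resolution_def
  proof (intro conjI)
    show "length ?sh = Suc (length ?D)" "?sh ! 0 = [0]" by simp_all
    let ?ok = "\<lambda>i. ?D ! i \<in> carrier_mat (length (?sh ! i)) (length (?sh ! Suc i)) \<and>
        (\<forall>r<length (?sh ! i). \<forall>c<length (?sh ! Suc i).
           form (?sh ! Suc i ! c - ?sh ! i ! r) (?D ! i $$ (r, c)) \<and> ?D ! i $$ (r, c) \<in> irrelevant)"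
    have len: "length ?D = Suc (Suc (Suc 0))" by simp
    have ok_0: "?ok 0"
      using carrier(1) entries(1)[of 0] form_irrelevant[OF entries(1)[of 0]] by simp
    have ok_1: "?ok (Suc 0)"
      using carrier(2) entries(2) form_irrelevant[OF entries(2)] by simp
    have ok_2: "?ok (Suc (Suc 0))"
      using carrier(3) entries(3)[of _ 0] form_irrelevant[OF entries(3)[of _ 0]] by simp
    show "\<forall>i<length ?D. ?ok i"
      unfolding len by (rule all_less_3[of ?ok, OF ok_0 ok_1 ok_2])
    have dims: "dim_col (row_mat f) = 3" "dim_col (mat3 A) = 3" "dim_col C = 1"
      using carrier by auto
    have image: "res_image ?sh ?D 0 = (\<lambda>v. row_mat f *\<^sub>v v) ` carrier_vec 3"
      "res_image ?sh ?D (Suc 0) = (\<lambda>v. mat3 A *\<^sub>v v) ` carrier_vec 3"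
      "res_image ?sh ?D (Suc (Suc 0)) = (\<lambda>v. C *\<^sub>v v) ` carrier_vec 1"
      "res_image ?sh ?D (Suc (Suc (Suc 0))) = {0\<^sub>v 1}"
      unfolding res_image_def by (simp_all add: dims)
    show "res_image ?sh ?D 0 = {v \<in> carrier_vec 1. v $ 0 \<in> ideal_gen (entries f)}"
      unfolding image image_row_mat ..
    have "{v. dot f v = 0} = range (mv A)" using ker_f by blast
    then have ker_0: "mat_kernel (?D ! 0) = res_image ?sh ?D (Suc 0)"
      unfolding image image_mat3 D kernel_row_mat by simp
    have "{v. mv A v = 0} = range (\<lambda>r. scale r vars)" using ker_A by blast
    then have ker_1: "mat_kernel (?D ! Suc 0) = res_image ?sh ?D (Suc (Suc 0))"
      unfolding image unfolding C_def image_col_mat nth_Cons_Suc nth_Cons_0 kernel_mat3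
      by (rule arg_cong)
    have ker_2: "mat_kernel (?D ! Suc (Suc 0)) = res_image ?sh ?D (Suc (Suc (Suc 0)))"
      unfolding image unfolding nth_Cons_Suc nth_Cons_0 C_def
      by (rule kernel_col_mat) (simp add: zero_prod_def)
    show "\<forall>i<length ?D. mat_kernel (?D ! i) = res_image ?sh ?D (Suc i)"
      unfolding len
      by (rule all_less_3[of "\<lambda>i. mat_kernel (?D ! i) = res_image ?sh ?D (Suc i)", OF ker_0 ker_1 ker_2])
  qed
  then show ?thesis ..
qed

section \<open>Saturation of a Cramer ideal\<close>

lemma vars_times_det3:
  assumes "t \<in> {var_x, var_y, var_z}"
  shows "t * det3 A \<in> ideal_gen (entries (cramer A vars))"
proof -
  have "t \<in> entries vars" using assms unfolding entries.simps .
  then have "det3 A * t \<in> entries (mv A (cramer A vars))"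
    unfolding mv_cramer entries_scale by (rule imageI)
  then obtain r where "det3 A * t = dot r (cramer A vars)" unfolding entries_mv by (rule imageE)
  then show ?thesis unfolding ideal_gen_entries mult.commute[of t] by (rule exI)
qed

lemma vars_times_minors:
  assumes h: "h \<in> ideal_gen (insert (det3 A) (entries (cramer A vars)))" and t: "t \<in> {var_x, var_y, var_z}"
  shows "t * h \<in> ideal_gen (entries (cramer A vars))" (is "_ \<in> ?I")
proof -
  obtain q v where "h = q * det3 A + dot v (cramer A vars)"
    using h unfolding ideal_gen_insert_entries by (elim exE)
  then have "t * h = q * (t * det3 A) + t * dot v (cramer A vars)"
    by (simp only: distrib_left mult.left_commute)
  moreover have "q * (t * det3 A) \<in> ?I"
    by (rule ideal_mult[OF is_ideal_gen vars_times_det3[OF t]])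
  moreover have "t * dot v (cramer A vars) \<in> ?I"
    by (rule ideal_mult[OF is_ideal_gen]) (unfold ideal_gen_entries, rule exI, rule refl)
  ultimately show ?thesis using ideal_add[OF is_ideal_gen] by (simp only:)
qed

lemma saturation_cramer_ideal:
  fixes A :: "'k::field poly3 triple triple"
  assumes g: "det3 A \<noteq> 0" and I: "codim (ideal_gen (entries (cramer A vars))) = 2"
  shows "saturation (ideal_gen (entries (cramer A vars))) = ideal_gen (insert (det3 A) (entries (cramer A vars)))"
proof (rule saturation_eqI[OF is_ideal_gen])
  show "ideal_gen (entries (cramer A vars)) \<subseteq> ideal_gen (insert (det3 A) (entries (cramer A vars)))"
    by (rule ideal_gen_mono) (rule subset_insertI)
  show "h \<in> ideal_gen (insert (det3 A) (entries (cramer A vars)))"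
    if "\<forall>t\<in>{var_x, var_y, var_z}. t * h \<in> ideal_gen (insert (det3 A) (entries (cramer A vars)))" for h
    using minors_saturated[OF g no_common_prime_of_minors[OF I] that] .
qed (rule vars_times_minors)

text \<open>In degrees below \<open>e\<close> the generator \<open>g\<close> cannot contribute.\<close>

lemma indeg_quotient_adjoin_form:
  assumes v: "forms (int d) v" and g: "form (int e) g" "g \<notin> ideal_gen (entries v)"
  shows "indeg_quotient (ideal_gen (insert g (entries v))) (ideal_gen (entries v)) = enat e"
  unfolding indeg_quotient_def
proof (rule antisym)
  let ?S = "{enat n |n. \<exists>f\<in>ideal_gen (insert g (entries v)). form (int n) f \<and> f \<notin> ideal_gen (entries v)}"
  have "g \<in> ideal_gen (insert g (entries v))" by (rule ideal_gen_base) (rule insertI1)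
  then have "enat e \<in> ?S" using g by blast
  then show "Inf ?S \<le> enat e" by (rule Inf_lower)
  show "enat e \<le> Inf ?S"
  proof (rule Inf_greatest)
    fix m assume "m \<in> ?S"
    then obtain n f where m: "m = enat n" and f: "f \<in> ideal_gen (insert g (entries v))" "form (int n) f"
      "f \<notin> ideal_gen (entries v)" by blast
    have "e \<le> n"
    proof (rule ccontr)
      assume "\<not> e \<le> n"
      obtain q t where qt: "f = q * g + dot t v"
        using f(1) unfolding ideal_gen_insert_entries by (elim exE)
      obtain c where c: "hcomp n (dot t v) = dot c v"
        using hcomp_dot_forms[OF v, of n t] by (elim exE conjE)
      have "f = hcomp n f" using hcomp_form[OF f(2), of n] by simp
      also have "\<dots> = dot c v"
        using \<open>\<not> e \<le> n\<close> unfolding qt hcomp_add hcomp_mult_form[OF g(1)] c by simp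
      finally have "f \<in> ideal_gen (entries v)" unfolding ideal_gen_entries by (rule exI)
      with f(3) show False ..
    qed
    then show "enat e \<le> m" by (simp add: m)
  qed
qed

lemma ideal_gen_ideal_Un: "ideal_gen (ideal_gen S \<union> {g}) = ideal_gen (insert g S)"
proof (rule ideal_gen_eqI)
  show "ideal_gen S \<union> {g} \<subseteq> ideal_gen (insert g S)"
    using ideal_gen_mono[of S "insert g S"] ideal_gen_base[of g "insert g S"] by auto
  show "insert g S \<subseteq> ideal_gen (ideal_gen S \<union> {g})"
    by (auto intro!: ideal_gen_base)
qed

lemma nonzero_entry:
  assumes "v \<noteq> 0"
  obtains a where "a \<in> entries v" "a \<noteq> 0"
proof -
  obtain a b c where v: "v = (a, b, c)" by (cases v)
  have "a \<noteq> 0 \<or> b \<noteq> 0 \<or> c \<noteq> 0" using assms by (auto simp: v zero_prod_def)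
  then show ?thesis using that unfolding v by auto
qed

lemma forms_degree_unique:
  assumes "forms d v" "forms e v" "v \<noteq> 0"
  shows "d = e"
proof -
  obtain a where a: "a \<in> entries v" "a \<noteq> 0" using assms(3) by (rule nonzero_entry)
  then show ?thesis using assms(1,2) form_degree_unique by blast
qed

text \<open>A relation with constant coefficients would express one generator by the two others.\<close>

lemma minimal_generators_independent:
  fixes f1 f2 f3 :: "'k::field poly3"
  assumes min: "minimally_generated_by I [f1, f2, f3]"
    and c: "forms 0 c" "dot c (f1, f2, f3) = 0"
  shows "c = 0"
proof -
  have nonmember: "a \<notin> ideal_gen (entries (f1, f2, f3) - {a})" if a: "a \<in> entries (f1, f2, f3)" for a
  proof
    assume mem: "a \<in> ideal_gen (entries (f1, f2, f3) - {a})"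
    have "ideal_gen (entries (f1, f2, f3) - {a}) = ideal_gen (entries (f1, f2, f3))"
    proof (rule ideal_gen_eqI)
      show "entries (f1, f2, f3) - {a} \<subseteq> ideal_gen (entries (f1, f2, f3))"
        by (auto intro: ideal_gen_base)
      show "entries (f1, f2, f3) \<subseteq> ideal_gen (entries (f1, f2, f3) - {a})"
        using mem ideal_gen_base[of _ "entries (f1, f2, f3) - {a}"] by blast
    qed
    moreover have "entries (f1, f2, f3) - {a} \<subset> set [f1, f2, f3]" using a by auto
    ultimately show False using min unfolding minimally_generated_by_def by auto
  qed
  have distinct: "f1 \<noteq> f2" "f1 \<noteq> f3" "f2 \<noteq> f3"
    using min by (auto simp: minimally_generated_by_def)
  have zero: "r = 0" if r: "form 0 r" "r * a + s * b + t * e = 0" and abe: "{a, b, e} = entries (f1, f2, f3)" "a \<noteq> b" "a \<noteq> e"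
    for r s t a b e :: "'k poly3"
  proof (rule ccontr)
    assume "r \<noteq> 0"
    with r(1) obtain u where "u * r = 1" using form_0_unit by blast
    then have "a = u * (r * a)" by (simp add: mult.assoc[symmetric])
    also have "r * a = - (s * b + t * e)"
      using r(2) unfolding add.assoc by (rule eq_neg_iff_add_eq_0[THEN iffD2])
    finally have a: "a = u * - (s * b + t * e)" .
    have "entries (f1, f2, f3) - {a} = {b, e}" unfolding abe(1)[symmetric] using abe(2,3) by auto
    then have "b \<in> ideal_gen (entries (f1, f2, f3) - {a})" "e \<in> ideal_gen (entries (f1, f2, f3) - {a})"
      by (simp_all add: ideal_gen_base)
    then have "u * - (s * b + t * e) \<in> ideal_gen (entries (f1, f2, f3) - {a})"
      by (intro ideal_mult ideal_uminus ideal_add is_ideal_gen)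
    then have mem: "a \<in> ideal_gen (entries (f1, f2, f3) - {a})" by (rule back_subst[of "\<lambda>h. h \<in> _", OF _ a[symmetric]])
    have "a \<in> entries (f1, f2, f3)" unfolding abe(1)[symmetric] by (rule insertI1)
    from nonmember[OF this] mem show False ..
  qed
  obtain c1 c2 c3 where cc: "c = (c1, c2, c3)" by (cases c)
  have forms: "form 0 c1" "form 0 c2" "form 0 c3" using c(1) by (simp_all add: cc)
  have eq: "c1 * f1 + c2 * f2 + c3 * f3 = 0" using c(2) by (simp add: cc)
  have "c1 = 0" by (rule zero[OF forms(1) eq]) (use distinct in auto)
  moreover have "c2 = 0"
  proof (rule zero[OF forms(2)])
    show "c2 * f2 + c1 * f1 + c3 * f3 = 0" using eq by (simp add: add_ac)
  qed (use distinct in auto)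
  moreover have "c3 = 0"
  proof (rule zero[OF forms(3)])
    show "c3 * f3 + c1 * f1 + c2 * f2 = 0" using eq by (simp add: add_ac)
  qed (use distinct in auto)
  ultimately show ?thesis by (simp add: cc zero_prod_def)
qed

definition ident :: "'a::comm_ring_1 triple triple" where
  "ident = ((1, 0, 0), (0, 1, 0), (0, 0, 1))"

lemma det3_ident: "det3 ident = 1"
  by (simp add: ident_def)

lemma constant_change_of_generators:
  assumes v: "forms (int d) v" and w: "forms (int d) w" and sub: "entries w \<subseteq> ideal_gen (entries v)"
  shows "\<exists>P. row_forms 0 P \<and> w = mv P v"
proof -
  obtain w1 w2 w3 where c: "w = (w1, w2, w3)" by (cases w)
  have "\<exists>r. h = dot r v \<and> forms 0 r" if "h \<in> entries w" for h
    using form_in_ideal_same_degree[OF v bspec[OF w that] subsetD[OF sub that]] .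
  from this[of w1] this[of w2] this[of w3] obtain r1 r2 r3 where
    "w1 = dot r1 v" "w2 = dot r2 v" "w3 = dot r3 v" "forms 0 r1" "forms 0 r2" "forms 0 r3"
    unfolding c by auto
  then have "row_forms 0 (r1, r2, r3)" "w = mv (r1, r2, r3) v" unfolding c by simp_all
  then show ?thesis by blast
qed

section \<open>Pivots and companions\<close>

lemma forms_diff: "forms e u \<Longrightarrow> forms e v \<Longrightarrow> forms e (u - v)"
  by (cases u rule: prod_cases3; cases v rule: prod_cases3) (simp add: form_diff)

lemma forms_in_ideal_degree_ge:
  fixes v w :: "'k::comm_ring_1 poly3 triple"
  assumes v: "forms (int d) v" and w: "forms (int e) w" "w \<noteq> 0" and sub: "entries w \<subseteq> ideal_gen (entries v)"
  shows "d \<le> e"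
proof -
  obtain a where a: "a \<in> entries w" "a \<noteq> 0" using w(2) by (rule nonzero_entry)
  show ?thesis
    by (rule form_in_ideal_degree_ge[OF v bspec[OF w(1) a(1)] a(2) subsetD[OF sub a(1)]])
qed

lemma xyz_cramer_mat3:
  fixes A :: "'k::field poly3 triple triple"
  assumes "row_forms (int s) A" "det3 A \<noteq> 0"
  shows "xyz_cramer s (ideal_gen (entries (cramer A vars))) (det3 A)"
  unfolding xyz_cramer_def
proof (intro exI conjI)
  show "mat3 A \<in> carrier_mat 3 3" by simp
  show "forms_mat s (mat3 A)" unfolding forms_mat_mat3 by (rule assms(1))
  show "det3 A = det (mat3 A)" by (rule det_mat3[symmetric])
  show "nonzerodivisor (det3 A)" using assms(2) by (simp add: nonzerodivisor_def)
  show "ideal_gen (entries (cramer A vars)) = cramer_ideal xyz (mat3 A)"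
    unfolding xyz_eq by (rule cramer_ideal_mat3[symmetric])
qed

lemma xyz_cramerD:
  fixes I :: "'k::field poly3 set"
  assumes "xyz_cramer s I g"
  obtains A where "row_forms (int s) A" "g = det3 A" "g \<noteq> 0" "I = ideal_gen (entries (cramer A vars))"
proof -
  obtain \<phi> where \<phi>: "\<phi> \<in> carrier_mat 3 3" "forms_mat s \<phi>" "g = det \<phi>" "nonzerodivisor g"
    "I = cramer_ideal xyz \<phi>"
    using assms unfolding xyz_cramer_def by (elim exE conjE)
  obtain A where A: "\<phi> = mat3 A" using \<phi>(1) by (rule mat3_surj)
  have "g * 1 \<noteq> 0" using \<phi>(4) unfolding nonzerodivisor_def by (metis zero_neq_one)
  then show ?thesis
    using that[of A] \<phi> unfolding A xyz_eq cramer_ideal_mat3 det_mat3 forms_mat_mat3 by simp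
qed

lemma content_matrix_mat3:
  assumes "row_forms (int s) A" "mv A f = scale g vars" "vec_of_list fs = vec3 f"
  shows "content_matrix fs g (prepend_col (vec3 vars) (mat3 A))"
  unfolding content_matrix_def
proof (intro exI conjI)
  show "mat3 A \<in> carrier_mat 3 3" by simp
  show "forms_mat s (mat3 A)" unfolding forms_mat_mat3 by (rule assms(1))
  show "mat3 A *\<^sub>v vec_of_list fs = g \<cdot>\<^sub>v xyz"
    unfolding assms(3) xyz_eq mat3_mult_vec3 assms(2) smult_vec3 ..
  show "prepend_col (vec3 vars) (mat3 A) = prepend_col xyz (mat3 A)" unfolding xyz_eq ..
qed

lemma content_matrixD:
  assumes "content_matrix fs g M" "vec_of_list fs = vec3 f"
  obtains s A where "row_forms (int s) A" "mv A f = scale g vars" "M = prepend_col (vec3 vars) (mat3 A)"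
proof -
  obtain \<phi> s where \<phi>: "\<phi> \<in> carrier_mat 3 3" "forms_mat s \<phi>" "\<phi> *\<^sub>v vec_of_list fs = g \<cdot>\<^sub>v xyz"
    "M = prepend_col xyz \<phi>"
    using assms(1) unfolding content_matrix_def by (elim exE conjE)
  obtain A where A: "\<phi> = mat3 A" using \<phi>(1) by (rule mat3_surj)
  have "vec3 (mv A f) = vec3 (scale g vars)"
    using \<phi>(3) unfolding A assms(2) xyz_eq mat3_mult_vec3 smult_vec3 .
  then have "mv A f = scale g vars" unfolding vec3_inject .
  then show ?thesis
    using that[of A s] \<phi>(2,4) unfolding A xyz_eq forms_mat_mat3 by iprover
qed

lemma pivot_consequences:
  fixes f :: "'k::alg_closed_field poly3 triple"
  assumes d: "d \<ge> 2" and I: "codim (ideal_gen (entries f)) = 2" and f: "forms (int d) f" "f \<noteq> 0"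
    and fs: "set fs = entries f" "vec_of_list fs = vec3 f"
    and pivot: "saturation_pivot fs g"
  shows "\<exists>s\<ge>1. d = 2 * s + 1 \<and> total_deg g = 3 * s \<and> xyz_cramer s (ideal_gen (entries f)) g \<and>
    saturation (ideal_gen (entries f)) = ideal_gen (ideal_gen (entries f) \<union> {g}) \<and>
    indeg_quotient (saturation (ideal_gen (entries f))) (ideal_gen (entries f)) = enat (3 * s) \<and>
    (\<exists>D. min_graded_free_resolution (ideal_gen (entries f))
      [[0], replicate 3 (int (2 * s + 1)), replicate 3 (int (3 * s + 2)), [int (3 * s + 3)]] D)"
proof -
  obtain M where g: "g \<notin> ideal_gen (entries f)" and M: "content_matrix fs g M" "codim (det_ideal 3 M) = 2"
    using pivot unfolding saturation_pivot_def fs(1) by (elim conjE exE) blast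
  obtain s A where A: "row_forms (int s) A" "mv A f = scale g vars" "M = prepend_col (vec3 vars) (mat3 A)"
    using M(1) fs(2) by (rule content_matrixD)
  have g0: "g \<noteq> 0" using g ideal_zero[OF is_ideal_gen] by metis
  obtain B u where B: "row_forms (int s) B" "g = det3 B" and u: "form 0 u" "u \<noteq> 0"
    and fB: "f = scale u (cramer B vars)"
    using pivot_is_maximal_minor[OF I f(2) A(1,2) g0 M(2)[unfolded A(3) det_ideal_mat3]]
    by (elim exE conjE)
  obtain w where "w * u = 1" using form_0_unit[OF u] by blast
  then have If: "ideal_gen (entries f) = ideal_gen (entries (cramer B vars))"
    unfolding fB by (rule ideal_gen_entries_scale_unit)
  have "forms (0 + int (2 * s + 1)) f"
    unfolding fB by (rule forms_scale[OF u(1) forms_cramer[OF B(1)]])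
  then have "0 + int (2 * s + 1) = int d" using f by (intro forms_degree_unique)
  then have ds: "d = 2 * s + 1" by simp
  have g_form: "form (int (3 * s)) g" unfolding B(2) by (rule form_det3[OF B(1)])
  have det: "det3 B \<noteq> 0" using g0 unfolding B(2) .
  have sat: "saturation (ideal_gen (entries f)) = ideal_gen (insert g (entries (cramer B vars)))"
    unfolding If B(2) by (rule saturation_cramer_ideal[OF det I[unfolded If]])
  from resolution_of_cramer_ideal[OF B(1) det no_common_prime_of_minors[OF I[unfolded If]] u fB]
  have res: "\<exists>D. min_graded_free_resolution (ideal_gen (entries f))
      [[0], replicate 3 (int (2 * s + 1)), replicate 3 (int (3 * s + 2)), [int (3 * s + 3)]] D" .
  show ?thesis
  proof (intro exI[of _ s] conjI)
    show "s \<ge> 1" using d ds by simp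
    show "d = 2 * s + 1" by (rule ds)
    show "total_deg g = 3 * s" using g_form g0 by (rule total_deg_form)
    show "xyz_cramer s (ideal_gen (entries f)) g"
      unfolding If B(2) by (rule xyz_cramer_mat3[OF B(1) det])
    show "saturation (ideal_gen (entries f)) = ideal_gen (ideal_gen (entries f) \<union> {g})"
      unfolding sat unfolding If ideal_gen_ideal_Un ..
    show "indeg_quotient (saturation (ideal_gen (entries f))) (ideal_gen (entries f)) = enat (3 * s)"
      unfolding sat unfolding If
      by (rule indeg_quotient_adjoin_form[OF forms_cramer[OF B(1)] g_form g[unfolded If]])
  qed (rule res)
qed

text \<open>The generators \<open>f\<close> and the minors \<open>D\<close> generate the same ideal. Comparing degrees in both directions, they
have the same degree, so \<open>f = P D\<close> and \<open>D = Q f\<close> with constant matrices, and \<open>P Q = 1\<close> because \<open>f\<close> is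
minimal. For the matrix \<open>A Q\<close> the minors that involve \<open>X\<close> are \<open>det Q\<close> times \<open>f\<close>.\<close>

lemma cramer_companion_is_pivot:
  fixes f1 f2 f3 :: "'k::field poly3"
  defines "f \<equiv> (f1, f2, f3)"
  assumes I: "codim I = 2" and min: "minimally_generated_by I [f1, f2, f3]"
    and f: "forms (int d) f"
    and nonsat: "saturation I \<noteq> I" and cramer: "xyz_cramer s I g"
  shows "sat_exponent I = 1 \<and> saturation_pivot [f1, f2, f3] g"
proof -
  have fs: "set [f1, f2, f3] = entries f" "vec_of_list [f1, f2, f3] = vec3 f"
    unfolding f_def vec3_of_list by simp_all
  have If: "I = ideal_gen (entries f)" using min unfolding minimally_generated_by_def fs by iprover
  obtain A where A: "row_forms (int s) A" "g = det3 A" "g \<noteq> 0" and IA: "I = ideal_gen (entries (cramer A vars))"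
    using cramer by (rule xyz_cramerD)
  define D where "D = cramer A vars"
  note IA = IA[folded D_def]
  have det: "det3 A \<noteq> 0" using A(3) unfolding A(2) .
  have D: "forms (int (2 * s + 1)) D" unfolding D_def by (rule forms_cramer[OF A(1)])
  have mvD: "mv A D = scale g vars" unfolding D_def A(2) by (rule mv_cramer)
  have sat: "saturation I = ideal_gen (insert g (entries D))"
    unfolding IA A(2) D_def by (rule saturation_cramer_ideal[OF det]) (fold D_def, fold IA, rule I)
  have kill: "t * h \<in> I" if h: "h \<in> saturation I" and t: "t \<in> {var_x, var_y, var_z}" for h t
    unfolding IA D_def
    by (rule vars_times_minors[OF _ t]) (use h in \<open>simp only: sat A(2) D_def\<close>)
  have g_sat: "g \<in> saturation I" unfolding sat by (rule ideal_gen_base[OF insertI1])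
  have ideal_I: "is_ideal I" unfolding If by (rule is_ideal_gen)
  have DI: "entries D \<subseteq> I" unfolding IA using ideal_gen_base by (rule subsetI)
  have fI: "entries f \<subseteq> I" unfolding If using ideal_gen_base by (rule subsetI)
  have gI: "g \<notin> I"
  proof
    assume "g \<in> I"
    then have "insert g (entries D) \<subseteq> I" using DI by (rule insert_subsetI)
    then have "saturation I \<subseteq> I" unfolding sat by (rule ideal_gen_least[OF ideal_I])
    then have "saturation I = I" using subset_saturation[OF ideal_I] by (rule subset_antisym)
    with nonsat show False ..
  qed
  have "D \<noteq> 0"
  proof
    assume "D = 0"
    then have "scale g vars = scale g 0" using mvD by (simp only: mv_linear scale_simps)
    then have "vars = (0 :: 'k poly3 triple)" using A(3) unfolding scale_cancel by iprover
    then show False by (simp add: zero_prod_def)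
  qed
  have "distinct [f1, f2, f3]" using min unfolding minimally_generated_by_def by (elim conjE)
  then have "f \<noteq> 0" unfolding f_def by (auto simp: zero_prod_def)
  have fD: "entries f \<subseteq> ideal_gen (entries D)" and Df: "entries D \<subseteq> ideal_gen (entries f)"
    unfolding IA[symmetric] If[symmetric] by (rule fI DI)+
  have "d = 2 * s + 1"
    using forms_in_ideal_degree_ge[OF f D \<open>D \<noteq> 0\<close> Df] forms_in_ideal_degree_ge[OF D f \<open>f \<noteq> 0\<close> fD]
    by (rule le_antisym)
  note D = D[folded this]
  obtain P where P: "row_forms 0 P" "f = mv P D"
    using constant_change_of_generators[OF D f fD] by (elim exE conjE)
  obtain Q where Q: "row_forms 0 Q" "D = mv Q f"
    using constant_change_of_generators[OF f D Df] by (elim exE conjE)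
  \<comment> \<open>Each row of \<open>P Q - 1\<close> is a constant relation between minimal generators.\<close>
  have PQ: "mm P Q = ident"
  proof -
    obtain r1 r2 r3 where r: "mm P Q = (r1, r2, r3)" by (cases "mm P Q")
    have "row_forms 0 (mm P Q)" using row_forms_mm[OF P(1) Q(1)] by simp
    then have forms: "forms 0 r1" "forms 0 r2" "forms 0 r3" unfolding r by simp_all
    have "mv (mm P Q) f = f" unfolding mv_mm Q(2)[symmetric] P(2)[symmetric] ..
    then have dots: "dot r1 f = f1" "dot r2 f = f2" "dot r3 f = f3" unfolding r f_def by simp_all
    have row: "p = e" if "forms 0 p" "forms 0 e" "dot p f = dot e f" for p e
    proof -
      have "p - e = 0"
        using minimal_generators_independent[OF min forms_diff[OF that(1,2)]] that(3)
        unfolding f_def[symmetric] dot_linear by simp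
      then show ?thesis by simp
    qed
    have one: "form 0 (1 :: 'k poly3)" using form_const[of "1 :: 'k"] by simp
    show ?thesis
      unfolding r ident_def prod.inject
      by (intro conjI row forms) (simp_all only: dots, simp_all add: one f_def)
  qed
  have detPQ: "det3 P * det3 Q = 1" unfolding det3_mm[symmetric] PQ det3_ident ..
  define A' where "A' = mm A Q"
  have A': "row_forms (int s) A'" using row_forms_mm[OF A(1) Q(1)] unfolding A'_def by simp
  have mvA': "mv A' f = scale g vars" unfolding A'_def mv_mm Q(2)[symmetric] by (rule mvD)
  have detA': "det3 A' = det3 Q * g" unfolding A'_def det3_mm A(2) by (rule mult.commute)
  have "det3 A' \<noteq> 0" using detPQ A(3) unfolding detA' by auto
  moreover have "mv A' (cramer A' vars) = mv A' (scale (det3 Q) f)"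
    unfolding mv_cramer mv_linear mvA' detA' scale_simps ..
  ultimately have cramerA': "cramer A' vars = scale (det3 Q) f" by (rule mv_inj)
  let ?J = "ideal_gen (insert (det3 A') (entries (cramer A' vars)))"
  have "codim ?J = 2"
  proof (rule codim_2_of_killed_by_irrelevant[OF I])
    have "entries f \<subseteq> ?J"
    proof
      fix h assume "h \<in> entries f"
      then have "det3 Q * h \<in> insert (det3 A') (entries (cramer A' vars))"
        unfolding cramerA' entries_scale by (intro insertI2 imageI)
      then have "det3 Q * h \<in> ?J" by (rule ideal_gen_base)
      then have "det3 P * (det3 Q * h) \<in> ?J" by (rule ideal_mult[OF is_ideal_gen])
      then show "h \<in> ?J" unfolding mult.assoc[symmetric] detPQ mult_1 .
    qed
    then show "I \<subseteq> ?J" unfolding If by (rule ideal_gen_least[OF is_ideal_gen])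
    have sat_ideal: "is_ideal (saturation I)" unfolding sat by (rule is_ideal_gen)
    have "entries f \<subseteq> saturation I"
      using fI subset_saturation[OF ideal_I] by (rule subset_trans)
    then have "insert (det3 A') (entries (cramer A' vars)) \<subseteq> saturation I"
      unfolding detA' cramerA' entries_scale using g_sat by (auto intro!: ideal_mult[OF sat_ideal])
    then have "?J \<subseteq> saturation I" by (rule ideal_gen_least[OF sat_ideal])
    then show "t * h \<in> I" if "h \<in> ?J" "t \<in> {var_x, var_y, var_z}" for h t
      using kill[OF _ that(2)] that(1) by blast
  qed
  then have "codim (det_ideal 3 (prepend_col (vec3 vars) (mat3 A'))) = 2" unfolding det_ideal_mat3 .
  moreover have "content_matrix [f1, f2, f3] g (prepend_col (vec3 vars) (mat3 A'))"
    using A' mvA' fs(2) by (rule content_matrix_mat3)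
  moreover have "form (int (3 * s)) g" unfolding A(2) by (rule form_det3[OF A(1)])
  ultimately have "saturation_pivot [f1, f2, f3] g"
    unfolding saturation_pivot_def fs(1) If[symmetric] using g_sat gI by blast
  moreover have "sat_exponent I = 1" using ideal_I nonsat kill by (rule sat_exponent_eq_1I)
  ultimately show ?thesis by (intro conjI)
qed

theorem theorem1p15:
  fixes I :: "'k::{alg_closed_field, field_char_0} poly3 set"
    and fs :: "'k poly3 list"
    and d :: nat
  assumes "d \<ge> 2"
    and "codim I = 2"
    and "length fs = 3"
    and "\<forall>f\<in>set fs. form (int d) f"
    and "minimally_generated_by I fs"
  shows
    "(\<forall>g. sat_exponent I = 1 \<and> GSC fs \<and> saturation_pivot fs g \<longrightarrow>
        (\<exists>s\<ge>1. xyz_cramer s I g \<and> total_deg g = d - 1 + s) \<and>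
        saturation I = ideal_gen (I \<union> {g}) \<and>
        odd d \<and>
        (real (total_deg g) = 3 / 2 * (real d - 1) \<and>
          (indeg_quotient (saturation I) I \<ge> enat (d + 1) \<longleftrightarrow> d \<ge> 5)) \<and>
        (\<exists>D. min_graded_free_resolution I
           [[0],
            replicate 3 (int d),
            replicate 3 ((3 * int d + 1) div 2),
            [3 * (int d + 1) div 2]] D)) \<and>
     (\<forall>g. saturation I \<noteq> I \<and> (\<exists>s. xyz_cramer s I g) \<longrightarrow>
        sat_exponent I = 1 \<and> GSC fs \<and> saturation_pivot fs g)"
proof -
  obtain f1 f2 f3 where fs: "fs = [f1, f2, f3]"
    using assms(3) by (auto simp: numeral_3_eq_3 length_Suc_conv)
  define f where "f = (f1, f2, f3)"
  have set_fs: "set fs = entries f" and vec_fs: "vec_of_list fs = vec3 f"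
    unfolding fs f_def vec3_of_list by simp_all
  have If: "I = ideal_gen (entries f)"
    using assms(5) unfolding minimally_generated_by_def set_fs by iprover
  have forms: "forms (int d) f" using assms(4) unfolding set_fs .
  have "distinct fs" using assms(5) unfolding minimally_generated_by_def by (elim conjE)
  then have f0: "f \<noteq> 0" unfolding fs f_def by (auto simp: zero_prod_def)
  have forward: "(\<exists>s\<ge>1. xyz_cramer s I g \<and> total_deg g = d - 1 + s) \<and>
        saturation I = ideal_gen (I \<union> {g}) \<and>
        odd d \<and>
        (real (total_deg g) = 3 / 2 * (real d - 1) \<and>
          (indeg_quotient (saturation I) I \<ge> enat (d + 1) \<longleftrightarrow> d \<ge> 5)) \<and>
        (\<exists>D. min_graded_free_resolution I
           [[0],
            replicate 3 (int d),
            replicate 3 ((3 * int d + 1) div 2),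
            [3 * (int d + 1) div 2]] D)"
    if pivot: "saturation_pivot fs g" for g
  proof -
    obtain s where s: "s \<ge> 1" and d: "d = 2 * s + 1" and deg: "total_deg g = 3 * s"
      and cramer: "xyz_cramer s I g" and sat: "saturation I = ideal_gen (I \<union> {g})"
      and indeg: "indeg_quotient (saturation I) I = enat (3 * s)"
      and res: "\<exists>D. min_graded_free_resolution I
        [[0], replicate 3 (int (2 * s + 1)), replicate 3 (int (3 * s + 2)), [int (3 * s + 3)]] D"
      using pivot_consequences[OF assms(1) assms(2)[unfolded If] forms f0 set_fs vec_fs pivot]
      unfolding If[symmetric] by (elim exE conjE) (rule that, assumption+, rule exI)
    have shifts: "(3 * int d + 1) div 2 = int (3 * s + 2)" "3 * (int d + 1) div 2 = int (3 * s + 3)"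
      unfolding d by simp_all
    show ?thesis
    proof (intro conjI)
      have "total_deg g = d - 1 + s" unfolding deg d by simp
      then show "\<exists>s\<ge>1. xyz_cramer s I g \<and> total_deg g = d - 1 + s" using s cramer by blast
      show "real (total_deg g) = 3 / 2 * (real d - 1)" unfolding deg d by simp
      show "enat (d + 1) \<le> indeg_quotient (saturation I) I \<longleftrightarrow> 5 \<le> d"
        unfolding indeg d by auto
      show "saturation I = ideal_gen (I \<union> {g})" by (rule sat)
      show "odd d" unfolding d by simp
      show "\<exists>D. min_graded_free_resolution I [[0], replicate 3 (int d),
          replicate 3 ((3 * int d + 1) div 2), [3 * (int d + 1) div 2]] D"
        unfolding shifts using res unfolding d .
    qed
  qed
  have backward: "sat_exponent I = 1 \<and> saturation_pivot fs g"
    if "saturation I \<noteq> I" "xyz_cramer s I g" for g s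
    unfolding fs
    by (rule cramer_companion_is_pivot[OF assms(2) assms(5)[unfolded fs] forms[unfolded f_def] that])
  show ?thesis
  proof (rule conjI; intro allI impI)
    fix g assume g: "saturation I \<noteq> I \<and> (\<exists>s. xyz_cramer s I g)"
    then obtain s where "xyz_cramer s I g" by blast
    with g have "sat_exponent I = 1 \<and> saturation_pivot fs g" using backward by blast
    then show "sat_exponent I = 1 \<and> GSC fs \<and> saturation_pivot fs g"
      unfolding GSC_def by blast
  qed (elim conjE, rule forward)
qed

end
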